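(* The flexure problem for closed cylindrical Koiter shells, consisting of the governing equations (listed in the context) and the end edge conditions $$\boldsymbol{\mathcal R}(\boldsymbol u)=\mathcal R_\alpha^0\,\boldsymbol e_\alpha,\qquad \boldsymbol{\mathcal M}(\boldsymbol u)=\boldsymbol 0,$$ with given $\mathcal R_1^0,\mathcal R_2^0$, admits the solution $$\begin{aligned}\hat{\boldsymbol u}=\;&-\Big[\big(\tfrac16z^3-\tfrac12\nu z\,x_\beta x_\beta\big)\hat A_\alpha+\nu z(\hat{\boldsymbol A}\cdot\hat{\boldsymbol r})x_\alpha+\tilde Kz\,e_{\alpha\beta}x_\beta\Big]\boldsymbol e_\alpha+\Big[\tfrac12z^2(\hat{\boldsymbol A}\cdot\hat{\boldsymbol r})+\tilde K\varphi(s)+\psi(s)\Big]\boldsymbol e_3\\&+\frac1C\,z\Big(s\,\hat{\boldsymbol B}\times\boldsymbol e_3-\int_0^s\frac1R(\hat{\boldsymbol B}\cdot\hat{\boldsymbol r})\boldsymbol\tau\,\mathrm d\sigma\Big)-z\int_0^s\boldsymbol n(\sigma)\int_0^\sigma\Big[\frac\nu R\hat{\boldsymbol A}+\Big(\frac1D+\frac1{CR^2}\Big)\hat{\boldsymbol B}\Big]\cdot\hat{\boldsymbol r}\,\mathrm dt\,\mathrm d\sigma,\end{aligned}$$ (in all integrals, the unlabelled functions are evaluated at the variable of integration), where $\hat{\boldsymbol r}=x_\alpha\boldsymbol e_\alpha+\bar s\,\boldsymbol e_3$, and $\hat{\boldsymbol A}=\hat A_i\boldsymbol e_i$, $\hat{\boldsymbol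 B}=\hat B_i\boldsymbol e_i$ are constant vectors, determined as follows. The coefficients $\hat B_i$ are determined in terms of $\hat A_i$ by the linear system ($\alpha=1,2$) $$\nu\hat{\boldsymbol A}\cdot\int_0^{\bar s}\frac1R\hat{\boldsymbol r}\,\mathrm ds+\hat{\boldsymbol B}\cdot\int_0^{\bar s}\Big(\frac1D+\frac1{CR^2}\Big)\hat{\boldsymbol r}\,\mathrm ds=0,$$ $$\nu\hat{\boldsymbol A}\cdot\int_0^{\bar s}\frac{x_\alpha}R\hat{\boldsymbol r}\,\mathrm ds+\hat{\boldsymbol B}\cdot\int_0^{\bar s}\Big[x_\alpha\Big(\frac1D+\frac1{CR^2}\Big)\hat{\boldsymbol r}+\frac1C\big(\boldsymbol e_\alpha+x_\alpha'\boldsymbol\tau\big)\Big]\mathrm ds=0.$$ The constants $\hat A_i$ are determined in terms of $\mathcal R_\alpha^0$ from the linear system ($\alpha=1,2$) $$C(1-\nu^2)\hat{\boldsymbol A}\cdot\int_0^{\bar s}\hat{\boldsymbol r}\,\mathrm ds-\nu\hat{\boldsymbol B}\cdot\int_0^{\bar s}\frac1R\hat{\boldsymbol r}\,\mathrm ds=0,$$ $$C(1-\nu^2)\hat{\boldsymbol A}\cdot\int_0^{\bar s}\Big(x_\alpha\hat{\boldsymbol r}+\frac DCe_{\alpha\beta}x_\beta'\boldsymbol n\Big)\mathrm ds-\nu\hat{\boldsymbol B}\cdot\int_0^{\bar s}\Big[x_\alpha\Big(\frac1R\hat{\boldsymbol r}+\boldsymbol n\Big)-e_{\alpha\beta}x_\beta'\hat{\boldsymbol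 r}\Big]\mathrm ds=-\mathcal R_\alpha^0 .$$ The torsion function is $\varphi(s)=\frac{2\mathcal A}{\bar s}s-\int_0^s\boldsymbol r\cdot\boldsymbol n\,\mathrm d\sigma$, with $\mathcal A=\frac12\int_0^{\bar s}\boldsymbol r\cdot\boldsymbol n\,\mathrm ds$ the area bounded by the closed cross-section curve. Put $$\boldsymbol G(s)=\frac\nu2(x_\alpha x_\alpha)\hat{\boldsymbol A}-\nu(\hat{\boldsymbol A}\cdot\hat{\boldsymbol r})\boldsymbol r+\frac1C\Big(s\,\hat{\boldsymbol B}\times\boldsymbol e_3-\int_0^s\frac1R(\hat{\boldsymbol B}\cdot\hat{\boldsymbol r})\boldsymbol\tau\,\mathrm d\sigma\Big)-\int_0^s\boldsymbol n(\sigma)\int_0^\sigma\Big[\frac\nu R\hat{\boldsymbol A}+\Big(\frac1D+\frac1{CR^2}\Big)\hat{\boldsymbol B}\Big]\cdot\hat{\boldsymbol r}\,\mathrm dt\,\mathrm d\sigma,$$ $$Q(s)=\int_0^s\Big[C(1-\nu^2)\hat{\boldsymbol A}\cdot\hat{\boldsymbol r}-\nu\hat{\boldsymbol B}\cdot\Big(\boldsymbol n+\frac1R\hat{\boldsymbol r}\Big)\Big]\mathrm d\sigma .$$ The flexure function is $$\psi(s)=-\int_0^s\Big\{\boldsymbol\tau\cdot\boldsymbol G+\frac2{C(1-\nu)}Q\Big\}\mathrm d\sigma+K_0s,\qquad K_0=\frac1{\bar s}\int_0^{\bar s}\Big\{\boldsymbol\tau\cdot\boldsymbol G+\frac2{C(1-\nu)}Q\Big\}\mathrm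 ds,$$ and the constant $\tilde K$ is given by $$\begin{aligned}\tilde K\Big[2(1-\nu)\Big(C\frac{\mathcal A^2}{\bar s}+D\bar s\Big)\Big]=\;&-C(1-\nu)\mathcal A K_0\\&+2D(1-\nu)\int_0^{\bar s}\Big\{\nu\hat{\boldsymbol A}\cdot(\boldsymbol r\times\boldsymbol e_3)-\int_0^s\Big[\frac\nu R\hat{\boldsymbol A}+\Big(\frac1D+\frac1{CR^2}\Big)\hat{\boldsymbol B}\Big]\cdot\hat{\boldsymbol r}\,\mathrm d\sigma\Big\}\mathrm ds\\&+\int_0^{\bar s}\Big\{(\boldsymbol r\cdot\boldsymbol\tau)\big[D(1-\nu^2)\hat{\boldsymbol A}\cdot\boldsymbol n+\nu\hat{\boldsymbol B}\cdot\hat{\boldsymbol r}\big]+(\boldsymbol r\cdot\boldsymbol n)\,Q(s)\Big\}\mathrm ds.\end{aligned}$$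
   Context: Indices and geometry. Greek indices range over $\{1,2\}$, Latin indices over $\{1,2,3\}$, repeated indices are summed, and a subscript comma denotes partial differentiation. $\boldsymbol e_1,\boldsymbol e_2,\boldsymbol e_3$ are the unit vectors along the axes of an orthogonal Cartesian frame $Ox_1x_2x_3$. $e_{\alpha\beta}$ is the two-dimensional alternator: $e_{12}=-e_{21}=1$, $e_{11}=e_{22}=0$. The midsurface $\mathcal S$ of a closed cylindrical shell (a thin tube of arbitrary cross-section) is parametrized by $\boldsymbol r(s,z)=x_\alpha(s)\boldsymbol e_\alpha+z\,\boldsymbol e_3$, $s\in[0,\bar s]$, $z\in[0,\ell]$, where $x_\alpha$ are given functions of class $C^2[0,\bar s]$ describing the closed cross-section curve, $s$ is the arclength parameter along it, and $\bar s$ is its length. $\mathcal C_0$ is the end edge $z=0$. Put $$\boldsymbol\tau=x_\alpha'(s)\boldsymbol e_\alpha,\qquad \boldsymbol n=e_{\alpha\beta}x_\beta'(s)\boldsymbol e_\alpha,\qquad \frac1{R(s)}=e_{\alpha\beta}x_\alpha'(s)x_\beta''(s),$$ so that $\boldsymbol\tau'=-\frac1R\boldsymbol n$ and $\boldsymbol n'=\frac1R\boldsymbol\tau$. Whenever $\boldsymbol r$ enters a function of $s$ alone, it does so only through products ($\boldsymbol r\cdot\boldsymbol n$, $\boldsymbol r\cdot\boldsymbol\tau$, $\boldsymbol r\times\boldsymbol e_3$) that do not depend on $z$; in particular, of $\boldsymbol G(s)$ only the scalar product $\boldsymbol\tau\cdot\boldsymbol G$ is used, so the $\boldsymbol e_3$-component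 of $\boldsymbol G$ is irrelevant. Material constants (isotropic homogeneous shell). $C=\frac{Eh}{1-\nu^2}$ and $D=\frac{Eh^3}{12(1-\nu^2)}$, where $E$ is the Young modulus, $\nu$ the Poisson ratio, and $h$ the thickness. Governing equations for a displacement field $\boldsymbol u(s,z)$ (vector-valued in $\mathbb R^3$). (i) Strains: $\epsilon_{ss}=\boldsymbol u_{,s}\cdot\boldsymbol\tau$, $\epsilon_{sz}=\epsilon_{zs}=\frac12(\boldsymbol u_{,z}\cdot\boldsymbol\tau+\boldsymbol u_{,s}\cdot\boldsymbol e_3)$, $\epsilon_{zz}=\boldsymbol u_{,z}\cdot\boldsymbol e_3$, $\rho_{ss}=\boldsymbol u_{,ss}\cdot\boldsymbol n$, $\rho_{sz}=\rho_{zs}=\boldsymbol u_{,sz}\cdot\boldsymbol n$, $\rho_{zz}=\boldsymbol u_{,zz}\cdot\boldsymbol n$. (ii) Constitutive relations: $N_{ss}=C(\epsilon_{ss}+\nu\epsilon_{zz})$, $N_{sz}=N_{zs}=C(1-\nu)\epsilon_{sz}$, $N_{zz}=C(\nu\epsilon_{ss}+\epsilon_{zz})$, $M_{ss}=D(\rho_{ss}+\nu\rho_{zz})$, $M_{sz}=M_{zs}=D(1-\nu)\rho_{sz}$, $M_{zz}=D(\nu\rho_{ss}+\rho_{zz})$; and $P_{ss}=N_{ss}-\frac1R M_{ss}$, $P_{sz}=N_{sz}-\frac1R M_{sz}$, $P_{zs}=N_{zs}$, $P_{zz}=N_{zz}$, $S_s=-M_{ss,s}-M_{zs,z}$, $S_z=-M_{sz,s}-M_{zz,z}$.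 (iii) Equilibrium equations (no body forces): $P_{ss,s}+P_{sz,z}+\frac1R S_s=0$, $P_{zs,s}+P_{zz,z}=0$, $S_{s,s}+S_{z,z}-\frac1R P_{ss}=0$. Since the tube is closed, a solution must also satisfy the continuity conditions $\boldsymbol u(0,z)=\boldsymbol u(\bar s,z)$, $\boldsymbol u_{,s}(0,z)=\boldsymbol u_{,s}(\bar s,z)$, $\boldsymbol u_{,ss}(0,z)=\boldsymbol u_{,ss}(\bar s,z)$ for all $z\in[0,\ell]$. Resultant functionals on $\mathcal C_0$ (integrals over $s\in[0,\bar s]$, quantities computed from $\boldsymbol u$ and evaluated at $z=0$): $$\boldsymbol{\mathcal R}(\boldsymbol u)=-\int_{\mathcal C_0}\big[P_{sz}\boldsymbol\tau+P_{zz}\boldsymbol e_3+S_z\boldsymbol n\big]\,\mathrm ds,$$ $$\boldsymbol{\mathcal M}(\boldsymbol u)=-\int_{\mathcal C_0}\Big[\boldsymbol r\times\big(P_{sz}\boldsymbol\tau+P_{zz}\boldsymbol e_3+S_z\boldsymbol n\big)-M_{sz}\boldsymbol e_3+M_{zz}\boldsymbol\tau\Big]\mathrm ds .$$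
   Formalization: For merely C² curves the vector u_{,ss} need not exist (it contains (1/R)'); ρ_ss is read as the s-derivative of u_{,s}·n with n frozen, and seam continuity of u_{,ss} covers only its n and e_3 components, the full vector only if x''' exists and agrees at both ends. *)

theory Defs
  imports "HOL-Analysis.Analysis"
begin

text \<open>Greek indices are elements of the type \<^typ>\<open>2\<close>; components with respect to the Cartesian
  frame of space are components of \<^typ>\<open>real ^ 3\<close>.\<close>

definition alt :: "2 \<Rightarrow> 2 \<Rightarrow> real" where
  "alt \<alpha> \<beta> = (if \<alpha> = 1 \<and> \<beta> = 2 then 1 else if \<alpha> = 2 \<and> \<beta> = 1 then -1 else 0)"

definition ee :: "2 \<Rightarrow> real ^ 3" where
  "ee \<alpha> = (if \<alpha> = 1 then axis 1 1 else axis 2 1)"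

definition e3 :: "real ^ 3" where
  "e3 = axis 3 1"

text \<open>Derivatives on a closed interval are one-sided at its end points. The value is only
  meaningful where the function is differentiable, so differentiability is always required
  separately below.\<close>

definition D_on :: "real \<Rightarrow> (real \<Rightarrow> 'a::real_normed_vector) \<Rightarrow> real \<Rightarrow> 'a" where
  "D_on b f t = vector_derivative f (at t within {0..b})"

definition closed_C2_curve :: "(real \<Rightarrow> real ^ 2) \<Rightarrow> real \<Rightarrow> bool" where
  "closed_C2_curve x sbar \<longleftrightarrow>
     x differentiable_on {0..sbar} \<and>
     D_on sbar x differentiable_on {0..sbar} \<and>
     continuous_on {0..sbar} (D_on sbar (D_on sbar x)) \<and>
     (\<forall>s\<in>{0..sbar}. norm (D_on sbar x s) = 1) \<and>
     x 0 = x sbar \<and>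
     D_on sbar x 0 = D_on sbar x sbar \<and>
     D_on sbar (D_on sbar x) 0 = D_on sbar (D_on sbar x) sbar"

text \<open>The curve is three times differentiable, also across the seam \<open>s = 0\<close>, \<open>s = sbar\<close>.\<close>

definition third_derivative_closed :: "(real \<Rightarrow> real ^ 2) \<Rightarrow> real \<Rightarrow> bool" where
  "third_derivative_closed x sbar \<longleftrightarrow>
     D_on sbar (D_on sbar x) differentiable_on {0..sbar} \<and>
     D_on sbar (D_on sbar (D_on sbar x)) 0 = D_on sbar (D_on sbar (D_on sbar x)) sbar"

locale koiter_tube =
  fixes x :: "real \<Rightarrow> real ^ 2" and sbar ell E h nu :: real
  assumes sbar_pos: "0 < sbar"
    and ell_pos: "0 < ell"
    and curve: "closed_C2_curve x sbar"
    and E_pos: "0 < E"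
    and h_pos: "0 < h"
    and nu_bounds: "-1 < nu" "nu < 1"
begin

subsection \<open>Geometry and material constants\<close>

definition dx :: "real \<Rightarrow> real ^ 2" where "dx = D_on sbar x"
definition ddx :: "real \<Rightarrow> real ^ 2" where "ddx = D_on sbar dx"

definition r :: "real \<Rightarrow> real \<Rightarrow> real ^ 3" where
  "r s z = (\<Sum>\<alpha>\<in>UNIV. x s $ \<alpha> *\<^sub>R ee \<alpha>) + z *\<^sub>R e3"

text \<open>The position vector in functions of \<open>s\<close> alone, where its axial component is irrelevant.\<close>

definition r0 :: "real \<Rightarrow> real ^ 3" where
  "r0 s = r s 0"

definition rhat :: "real \<Rightarrow> real ^ 3" where
  "rhat s = (\<Sum>\<alpha>\<in>UNIV. x s $ \<alpha> *\<^sub>R ee \<alpha>) + sbar *\<^sub>R e3"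

definition tau :: "real \<Rightarrow> real ^ 3" where
  "tau s = (\<Sum>\<alpha>\<in>UNIV. dx s $ \<alpha> *\<^sub>R ee \<alpha>)"

definition nrm :: "real \<Rightarrow> real ^ 3" where
  "nrm s = (\<Sum>\<alpha>\<in>UNIV. (\<Sum>\<beta>\<in>UNIV. alt \<alpha> \<beta> * dx s $ \<beta>) *\<^sub>R ee \<alpha>)"

text \<open>The curvature \<open>1/R\<close>.\<close>

definition kappa :: "real \<Rightarrow> real" where
  "kappa s = (\<Sum>\<alpha>\<in>UNIV. \<Sum>\<beta>\<in>UNIV. alt \<alpha> \<beta> * dx s $ \<alpha> * ddx s $ \<beta>)"

definition C :: real where "C = E * h / (1 - nu\<^sup>2)"
definition D :: real where "D = E * h ^ 3 / (12 * (1 - nu\<^sup>2))"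

subsection \<open>Governing equations\<close>

definition ds :: "(real \<Rightarrow> real \<Rightarrow> 'a::real_normed_vector) \<Rightarrow> real \<Rightarrow> real \<Rightarrow> 'a" where
  "ds f s z = D_on sbar (\<lambda>\<sigma>. f \<sigma> z) s"

definition dz :: "(real \<Rightarrow> real \<Rightarrow> 'a::real_normed_vector) \<Rightarrow> real \<Rightarrow> real \<Rightarrow> 'a" where
  "dz f s z = D_on ell (\<lambda>\<zeta>. f s \<zeta>) z"

definition has_ds :: "(real \<Rightarrow> real \<Rightarrow> 'a::real_normed_vector) \<Rightarrow> bool" where
  "has_ds f \<longleftrightarrow> (\<forall>z\<in>{0..ell}. (\<lambda>\<sigma>. f \<sigma> z) differentiable_on {0..sbar})"

definition has_dz :: "(real \<Rightarrow> real \<Rightarrow> 'a::real_normed_vector) \<Rightarrow> bool" where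
  "has_dz f \<longleftrightarrow> (\<forall>s\<in>{0..sbar}. (\<lambda>\<zeta>. f s \<zeta>) differentiable_on {0..ell})"

text \<open>The component of \<open>u\<^bsub>,ss\<^esub>\<close> in the fixed direction \<open>d\<close>. For a cross-section that is merely
  \<open>C\<^sup>2\<close> the tangential component of \<open>u\<^bsub>,ss\<^esub>\<close> of the flexure solution involves the derivative
  of \<open>1/R\<close> and need not exist, whereas the normal and axial components do. Wherever the vector
  \<open>u\<^bsub>,ss\<^esub>\<close> exists, this is its scalar product with \<open>d\<close> (lemma \<open>ss_comp_eq\<close>).\<close>

definition has_ss_comp :: "(real \<Rightarrow> real \<Rightarrow> real ^ 3) \<Rightarrow> real ^ 3 \<Rightarrow> real \<Rightarrow> real \<Rightarrow> bool" where
  "has_ss_comp u d s z \<longleftrightarrow> (\<lambda>\<sigma>. ds u \<sigma> z \<bullet> d) differentiable (at s within {0..sbar})"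

definition ss_comp :: "(real \<Rightarrow> real \<Rightarrow> real ^ 3) \<Rightarrow> real ^ 3 \<Rightarrow> real \<Rightarrow> real \<Rightarrow> real" where
  "ss_comp u d s z = D_on sbar (\<lambda>\<sigma>. ds u \<sigma> z \<bullet> d) s"

lemma ss_comp_eq:
  assumes "(\<lambda>\<sigma>. ds u \<sigma> z) differentiable (at s within {0..sbar})" and s: "s \<in> {0..sbar}"
  shows "has_ss_comp u d s z" and "ss_comp u d s z = ds (ds u) s z \<bullet> d"
proof -
  have *: "((\<lambda>\<sigma>. ds u \<sigma> z) has_vector_derivative ds (ds u) s z) (at s within {0..sbar})"
    using assms(1) by (simp add: ds_def D_on_def vector_derivative_works[symmetric])
  have **: "((\<lambda>\<sigma>. ds u \<sigma> z \<bullet> d) has_vector_derivative ds (ds u) s z \<bullet> d) (at s within {0..sbar})"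
    using bounded_linear.has_vector_derivative[OF bounded_linear_inner_left *] .
  show "has_ss_comp u d s z"
    unfolding has_ss_comp_def using ** by (rule differentiableI_vector)
  show "ss_comp u d s z = ds (ds u) s z \<bullet> d"
    unfolding ss_comp_def D_on_def
    using vector_derivative_within_closed_interval[OF sbar_pos s **] by simp
qed

definition eps_ss where "eps_ss u s z = ds u s z \<bullet> tau s"
definition eps_sz where "eps_sz u s z = (dz u s z \<bullet> tau s + ds u s z \<bullet> e3) / 2"
definition eps_zz where "eps_zz u s z = dz u s z \<bullet> e3"
definition rho_ss where "rho_ss u s z = ss_comp u (nrm s) s z"
definition rho_sz where "rho_sz u s z = dz (ds u) s z \<bullet> nrm s"
definition rho_zz where "rho_zz u s z = dz (dz u) s z \<bullet> nrm s"

definition N_ss where "N_ss u s z = C * (eps_ss u s z + nu * eps_zz u s z)"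
definition N_sz where "N_sz u s z = C * (1 - nu) * eps_sz u s z"
definition N_zz where "N_zz u s z = C * (nu * eps_ss u s z + eps_zz u s z)"
definition M_ss where "M_ss u s z = D * (rho_ss u s z + nu * rho_zz u s z)"
definition M_sz where "M_sz u s z = D * (1 - nu) * rho_sz u s z"
definition M_zz where "M_zz u s z = D * (nu * rho_ss u s z + rho_zz u s z)"

abbreviation "N_zs \<equiv> N_sz"
abbreviation "M_zs \<equiv> M_sz"

definition P_ss where "P_ss u s z = N_ss u s z - kappa s * M_ss u s z"
definition P_sz where "P_sz u s z = N_sz u s z - kappa s * M_sz u s z"
definition P_zs where "P_zs u s z = N_zs u s z"
definition P_zz where "P_zz u s z = N_zz u s z"
definition S_s where "S_s u s z = - ds (M_ss u) s z - dz (M_zs u) s z"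
definition S_z where "S_z u s z = - ds (M_sz u) s z - dz (M_zz u) s z"

text \<open>All derivatives that occur in the governing equations exist.\<close>

definition regular :: "(real \<Rightarrow> real \<Rightarrow> real ^ 3) \<Rightarrow> bool" where
  "regular u \<longleftrightarrow>
     has_ds u \<and> has_dz u \<and> has_dz (ds u) \<and> has_dz (dz u) \<and>
     (\<forall>s\<in>{0..sbar}. \<forall>z\<in>{0..ell}. has_ss_comp u (nrm s) s z) \<and>
     has_ds (M_ss u) \<and> has_ds (M_sz u) \<and> has_dz (M_zs u) \<and> has_dz (M_zz u) \<and>
     has_ds (P_ss u) \<and> has_ds (P_zs u) \<and> has_dz (P_sz u) \<and> has_dz (P_zz u) \<and>
     has_ds (S_s u) \<and> has_dz (S_z u)"

definition equilibrium :: "(real \<Rightarrow> real \<Rightarrow> real ^ 3) \<Rightarrow> bool" where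
  "equilibrium u \<longleftrightarrow>
     (\<forall>s\<in>{0..sbar}. \<forall>z\<in>{0..ell}.
        ds (P_ss u) s z + dz (P_sz u) s z + kappa s * S_s u s z = 0 \<and>
        ds (P_zs u) s z + dz (P_zz u) s z = 0 \<and>
        ds (S_s u) s z + dz (S_z u) s z - kappa s * P_ss u s z = 0)"

text \<open>Continuity across the seam: the second-order condition is split into the part which makes
  sense for every \<open>C\<^sup>2\<close> cross-section and the condition for the full vector \<open>u\<^bsub>,ss\<^esub>\<close>.\<close>

definition seam_continuity :: "(real \<Rightarrow> real \<Rightarrow> real ^ 3) \<Rightarrow> bool" where
  "seam_continuity u \<longleftrightarrow>
     (\<forall>z\<in>{0..ell}.
        u 0 z = u sbar z \<and>
        ds u 0 z = ds u sbar z \<and>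
        (\<forall>d\<in>{nrm, \<lambda>_. e3}.
           has_ss_comp u (d 0) 0 z \<and> has_ss_comp u (d sbar) sbar z \<and>
           ss_comp u (d 0) 0 z = ss_comp u (d sbar) sbar z))"

definition seam_continuity_ss :: "(real \<Rightarrow> real \<Rightarrow> real ^ 3) \<Rightarrow> bool" where
  "seam_continuity_ss u \<longleftrightarrow>
     has_ds (ds u) \<and> (\<forall>z\<in>{0..ell}. ds (ds u) 0 z = ds (ds u) sbar z)"

subsection \<open>Resultants on the end edge and the flexure problem\<close>

definition edge_force :: "(real \<Rightarrow> real \<Rightarrow> real ^ 3) \<Rightarrow> real \<Rightarrow> real ^ 3" where
  "edge_force u s = P_sz u s 0 *\<^sub>R tau s + P_zz u s 0 *\<^sub>R e3 + S_z u s 0 *\<^sub>R nrm s"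

definition edge_moment :: "(real \<Rightarrow> real \<Rightarrow> real ^ 3) \<Rightarrow> real \<Rightarrow> real ^ 3" where
  "edge_moment u s =
     cross3 (r s 0) (edge_force u s) - M_sz u s 0 *\<^sub>R e3 + M_zz u s 0 *\<^sub>R tau s"

definition resultant_force :: "(real \<Rightarrow> real \<Rightarrow> real ^ 3) \<Rightarrow> real ^ 3" where
  "resultant_force u = - integral {0..sbar} (edge_force u)"

definition resultant_moment :: "(real \<Rightarrow> real \<Rightarrow> real ^ 3) \<Rightarrow> real ^ 3" where
  "resultant_moment u = - integral {0..sbar} (edge_moment u)"

definition flexure_solution :: "real ^ 2 \<Rightarrow> (real \<Rightarrow> real \<Rightarrow> real ^ 3) \<Rightarrow> bool" where
  "flexure_solution R0 u \<longleftrightarrow>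
     regular u \<and> equilibrium u \<and> seam_continuity u \<and>
     edge_force u integrable_on {0..sbar} \<and>
     edge_moment u integrable_on {0..sbar} \<and>
     resultant_force u = (\<Sum>\<alpha>\<in>UNIV. R0 $ \<alpha> *\<^sub>R ee \<alpha>) \<and>
     resultant_moment u = 0"

subsection \<open>The linear systems for the constant vectors\<close>

text \<open>The compliance factor \<open>1/D + 1/(C R\<^sup>2)\<close>.\<close>

definition cmpl :: "real \<Rightarrow> real" where
  "cmpl s = 1 / D + (kappa s)\<^sup>2 / C"

definition B_system :: "real ^ 3 \<Rightarrow> real ^ 3 \<Rightarrow> bool" where
  "B_system A B \<longleftrightarrow>
     nu * (A \<bullet> integral {0..sbar} (\<lambda>s. kappa s *\<^sub>R rhat s)) +
       B \<bullet> integral {0..sbar} (\<lambda>s. cmpl s *\<^sub>R rhat s) = 0 \<and>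
     (\<forall>\<alpha>. nu * (A \<bullet> integral {0..sbar} (\<lambda>s. (x s $ \<alpha> * kappa s) *\<^sub>R rhat s)) +
       B \<bullet> integral {0..sbar} (\<lambda>s. (x s $ \<alpha> * cmpl s) *\<^sub>R rhat s +
             (1 / C) *\<^sub>R (ee \<alpha> + dx s $ \<alpha> *\<^sub>R tau s)) = 0)"

definition A_system :: "real ^ 2 \<Rightarrow> real ^ 3 \<Rightarrow> real ^ 3 \<Rightarrow> bool" where
  "A_system R0 A B \<longleftrightarrow>
     C * (1 - nu\<^sup>2) * (A \<bullet> integral {0..sbar} rhat) -
       nu * (B \<bullet> integral {0..sbar} (\<lambda>s. kappa s *\<^sub>R rhat s)) = 0 \<and>
     (\<forall>\<alpha>. C * (1 - nu\<^sup>2) *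
         (A \<bullet> integral {0..sbar} (\<lambda>s. x s $ \<alpha> *\<^sub>R rhat s +
             (D / C * (\<Sum>\<beta>\<in>UNIV. alt \<alpha> \<beta> * dx s $ \<beta>)) *\<^sub>R nrm s)) -
       nu * (B \<bullet> integral {0..sbar} (\<lambda>s. x s $ \<alpha> *\<^sub>R (kappa s *\<^sub>R rhat s + nrm s) -
             (\<Sum>\<beta>\<in>UNIV. alt \<alpha> \<beta> * dx s $ \<beta>) *\<^sub>R rhat s)) = - R0 $ \<alpha>)"

subsection \<open>The torsion function, the flexure function and the solution\<close>

definition area :: real where
  "area = 1 / 2 * integral {0..sbar} (\<lambda>s. r0 s \<bullet> nrm s)"

definition phi :: "real \<Rightarrow> real" where
  "phi s = 2 * area / sbar * s - integral {0..s} (\<lambda>\<sigma>. r0 \<sigma> \<bullet> nrm \<sigma>)"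

definition F :: "real ^ 3 \<Rightarrow> real ^ 3 \<Rightarrow> real \<Rightarrow> real" where
  "F A B s = integral {0..s} (\<lambda>t. ((nu * kappa t) *\<^sub>R A + cmpl t *\<^sub>R B) \<bullet> rhat t)"

text \<open>The terms containing integrals which the solution (multiplied by \<open>z\<close>) and the function
  \<open>G\<close> have in common.\<close>

definition W :: "real ^ 3 \<Rightarrow> real ^ 3 \<Rightarrow> real \<Rightarrow> real ^ 3" where
  "W A B s =
     (1 / C) *\<^sub>R (s *\<^sub>R cross3 B e3 -
        integral {0..s} (\<lambda>\<sigma>. (kappa \<sigma> * (B \<bullet> rhat \<sigma>)) *\<^sub>R tau \<sigma>)) -
     integral {0..s} (\<lambda>\<sigma>. F A B \<sigma> *\<^sub>R nrm \<sigma>)"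

definition G :: "real ^ 3 \<Rightarrow> real ^ 3 \<Rightarrow> real \<Rightarrow> real ^ 3" where
  "G A B s =
     (nu / 2 * (\<Sum>\<alpha>\<in>UNIV. x s $ \<alpha> * x s $ \<alpha>)) *\<^sub>R A -
     (nu * (A \<bullet> rhat s)) *\<^sub>R r0 s + W A B s"

definition Q :: "real ^ 3 \<Rightarrow> real ^ 3 \<Rightarrow> real \<Rightarrow> real" where
  "Q A B s = integral {0..s} (\<lambda>\<sigma>. C * (1 - nu\<^sup>2) * (A \<bullet> rhat \<sigma>) -
     nu * (B \<bullet> (nrm \<sigma> + kappa \<sigma> *\<^sub>R rhat \<sigma>)))"

definition K0 :: "real ^ 3 \<Rightarrow> real ^ 3 \<Rightarrow> real" where
  "K0 A B = 1 / sbar *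
     integral {0..sbar} (\<lambda>s. tau s \<bullet> G A B s + 2 / (C * (1 - nu)) * Q A B s)"

definition psi :: "real ^ 3 \<Rightarrow> real ^ 3 \<Rightarrow> real \<Rightarrow> real" where
  "psi A B s =
     - integral {0..s} (\<lambda>\<sigma>. tau \<sigma> \<bullet> G A B \<sigma> + 2 / (C * (1 - nu)) * Q A B \<sigma>) + K0 A B * s"

definition K_equation :: "real ^ 3 \<Rightarrow> real ^ 3 \<Rightarrow> real \<Rightarrow> bool" where
  "K_equation A B K \<longleftrightarrow>
     K * (2 * (1 - nu) * (C * area\<^sup>2 / sbar + D * sbar)) =
       - C * (1 - nu) * area * K0 A B +
       2 * D * (1 - nu) *
         integral {0..sbar} (\<lambda>s. nu * (A \<bullet> cross3 (r0 s) e3) - F A B s) +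
       integral {0..sbar} (\<lambda>s.
         (r0 s \<bullet> tau s) * (D * (1 - nu\<^sup>2) * (A \<bullet> nrm s) + nu * (B \<bullet> rhat s)) +
         (r0 s \<bullet> nrm s) * Q A B s)"

definition u_hat :: "real ^ 3 \<Rightarrow> real ^ 3 \<Rightarrow> real \<Rightarrow> real \<Rightarrow> real \<Rightarrow> real ^ 3" where
  "u_hat A B K s z =
     - (\<Sum>\<alpha>\<in>UNIV.
          ((z ^ 3 / 6 - nu * z / 2 * (\<Sum>\<beta>\<in>UNIV. x s $ \<beta> * x s $ \<beta>)) * (A \<bullet> ee \<alpha>) +
           nu * z * (A \<bullet> rhat s) * x s $ \<alpha> +
           K * z * (\<Sum>\<beta>\<in>UNIV. alt \<alpha> \<beta> * x s $ \<beta>)) *\<^sub>R ee \<alpha>) +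
     (z\<^sup>2 / 2 * (A \<bullet> rhat s) + K * phi s + psi A B s) *\<^sub>R e3 +
     z *\<^sub>R W A B s"

end

end

theory Submission
  imports Defs
begin

text \<open>
  Write \<open>a = A \<bullet> rhat\<close> and \<open>b = B \<bullet> rhat\<close>. The idea is to collect the displacement by powers of \<open>z\<close>,
  \[ u = -\frac{z^3}{6} A_\perp + \frac{z^2}{2} a e_3 + z H + k e_3, \]
  with \<open>A\<^sub>\<perp>\<close> the transverse part of \<open>A\<close>, a field \<open>H\<close> in the plane of the cross-section
  (\<open>planar\<close>) and an axial displacement \<open>k\<close> (\<open>warp\<close>). The integrals in the definition of \<open>u\<close> are
  such that the derivative of \<open>H\<close> has the short form \<open>H' = - hoop \<tau> + twist n\<close>, and \<open>k\<close> is
  chosen so that the shear strain depends on \<open>s\<close> only through \<open>Q\<close> (lemmas \<open>planar_deriv\<close> and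
  \<open>warp_deriv\<close>). Hence every stress resultant is explicit and at most linear in \<open>z\<close> (lemma
  \<open>stresses\<close>): \<open>P_ss = - z B \<bullet> n\<close>, \<open>M_ss = - z b\<close>, \<open>P_zz = z Q'\<close>, \<open>S_s = z B \<bullet> \<tau>\<close>, and so
  on. The three equilibrium equations then reduce to \<open>\<tau>' = - \<kappa> n\<close>, \<open>n' = \<kappa> \<tau>\<close> and the fact
  that \<open>Q'\<close> is the derivative of \<open>Q\<close>.

  What is left are conditions on the whole cross-section. Going once around it, \<open>F\<close> and \<open>W\<close> must
  return to their initial values. After integration by parts this says that one vector
  \<open>seam_gap A B\<close> vanishes, which is the system for \<open>B\<close> (lemmas \<open>B_system_iff\<close> and
  \<open>seam_gap_closed\<close>). Likewise the integral of the edge force differs from a vector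
  \<open>edge_load A B\<close> only by the integral of the derivative of a periodic function, and the system for
  \<open>A\<close> says that \<open>edge_load A B\<close> is opposite to the prescribed force (lemmas \<open>A_system_iff\<close> and
  \<open>edge_force_integral\<close>); its axial component makes \<open>Q\<close>, hence the shear strain, periodic. Finally
  the edge moment is axial, and the equation for the torsion constant says that its integral
  vanishes (lemma \<open>edge_moment_integral\<close>).

  The linear systems are uniquely solvable because \<open>(A, B) \<mapsto> (edge_load A B, seam_gap A B)\<close> is a
  positive definite operator: its work \<open>A \<bullet> edge_load A B + B \<bullet> seam_gap A B\<close> is the integral of a
  sum of squares, since the coupling through \<open>\<nu>/R\<close> cancels and the remaining mixed terms integrate to
  zero around the closed curve (lemmas \<open>edge_load_seam_gap_work\<close> and
  \<open>edge_load_seam_gap_injective\<close>).\<close>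

section \<open>Vectors of the plane and of space\<close>

definition lift :: "real ^ 2 \<Rightarrow> real ^ 3" where
  "lift v = (\<Sum>\<alpha>\<in>UNIV. v $ \<alpha> *\<^sub>R ee \<alpha>)"

lemma lift_nth [simp]: "lift v $ 1 = v $ 1" "lift v $ 2 = v $ 2" "lift v $ 3 = 0"
  by (simp_all add: lift_def sum_2 ee_def axis_def)

lemma lift_inner [simp]: "lift v \<bullet> lift w = v \<bullet> w"
  by (simp add: inner_vec_def sum_2 sum_3)

lemma e3_nth [simp]: "e3 $ 1 = 0" "e3 $ 2 = 0" "e3 $ 3 = 1"
  by (simp_all add: e3_def axis_def)

lemma ee_nth [simp]: "ee \<alpha> $ 1 = (if \<alpha> = 1 then 1 else 0)" "ee \<alpha> $ 2 = (if \<alpha> = 1 then 0 else 1)"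
  "ee \<alpha> $ 3 = 0"
  by (simp_all add: ee_def axis_def)

lemma bounded_linear_lift: "bounded_linear lift"
  by (rule linear_conv_bounded_linear[THEN iffD1], rule linearI)
    (simp_all add: vec_eq_iff forall_3)

lemma inner_e3 [simp]: "v \<bullet> e3 = v $ 3" "e3 \<bullet> v = v $ 3"
  by (simp_all add: inner_vec_def sum_3)

lemma has_real_derivative_inner:
  fixes f g :: "real \<Rightarrow> 'a::real_inner"
  assumes "(f has_vector_derivative f') (at s within S)" "(g has_vector_derivative g') (at s within S)"
  shows "((\<lambda>t. f t \<bullet> g t) has_real_derivative (f s \<bullet> g' + f' \<bullet> g s)) (at s within S)"
  using bounded_bilinear.has_vector_derivative[OF bounded_bilinear_inner assms]
  by (simp add: has_real_derivative_iff_has_vector_derivative)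

lemma inner_const_deriv:
  assumes "(g has_vector_derivative g') (at s within S)"
  shows "((\<lambda>s. v \<bullet> g s) has_real_derivative v \<bullet> g') (at s within S)"
  using has_real_derivative_inner[OF has_vector_derivative_const assms] by simp

lemma bounded_linear_cross3_left: "bounded_linear (\<lambda>v. cross3 v w)"
  by (rule linear_conv_bounded_linear[THEN iffD1], rule linearI)
    (simp_all add: cross_add_left cross_mult_left)

lemmas has_vector_derivative_cross3_const =
  bounded_linear.has_vector_derivative[OF bounded_linear_cross3_left]

text \<open>The factor \<open>g\<close> is merely continuous: the difference quotient of the product at \<open>s\<close> is \<open>g\<close> times
  that of \<open>k\<close>, because \<open>k\<close> vanishes there.
  This is what gives the normal component of \<open>u\<^bsub>,ss\<^esub>\<close> a meaning on a \<open>C\<^sup>2\<close> curve, whose curvature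
  need not be differentiable.\<close>

lemma has_real_derivative_mult_vanishing:
  fixes g k :: "real \<Rightarrow> real"
  assumes g: "continuous (at s within S) g"
    and k: "(k has_real_derivative k') (at s within S)" and "k s = 0"
  shows "((\<lambda>t. g t * k t) has_real_derivative g s * k') (at s within S)"
proof -
  have "((\<lambda>t. g t * ((k t - k s) / (t - s))) \<longlongrightarrow> g s * k') (at s within S)"
    using g k by (intro tendsto_mult) (simp_all add: continuous_within has_field_derivative_iff)
  then show ?thesis
    using \<open>k s = 0\<close> by (simp add: has_field_derivative_iff)
qed

lemma inner_integral:
  fixes f :: "real \<Rightarrow> 'a::euclidean_space"
  assumes "f integrable_on S"
  shows "v \<bullet> integral S f = integral S (\<lambda>s. v \<bullet> f s)"
  using integral_linear[OF assms bounded_linear_inner_right[of v]] by (simp add: o_def)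

definition transv :: "real ^ 3 \<Rightarrow> real ^ 3" where
  "transv v = v - (v \<bullet> e3) *\<^sub>R e3"

lemma transv_nth [simp]: "transv v $ 1 = v $ 1" "transv v $ 2 = v $ 2" "transv v $ 3 = 0"
  by (simp_all add: transv_def)

lemma transv_inner: "transv v \<bullet> w = v \<bullet> w - v $ 3 * w $ 3"
  by (simp add: transv_def inner_diff_left)

lemma D_on_works:
  assumes "f differentiable_on {0..b}" "t \<in> {0..b}"
  shows "(f has_vector_derivative D_on b f t) (at t within {0..b})"
  using assms unfolding D_on_def differentiable_on_def
  by (simp add: vector_derivative_works[symmetric])

lemma D_on_eqI:
  fixes f :: "real \<Rightarrow> 'a::euclidean_space"
  assumes "0 < b" "t \<in> {0..b}" "(f has_vector_derivative f') (at t within {0..b})"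
  shows "D_on b f t = f'"
  using assms unfolding D_on_def by (intro vector_derivative_within_closed_interval)

lemma has_vector_derivative_unique_on:
  fixes f :: "real \<Rightarrow> 'a::euclidean_space"
  assumes "0 < b" "t \<in> {0..b}" "(f has_vector_derivative u) (at t within {0..b})"
    "(f has_vector_derivative v) (at t within {0..b})"
  shows "u = v"
  using D_on_eqI[OF assms(1,2,3)] D_on_eqI[OF assms(1,2,4)] by simp

section \<open>Geometry of the cross-section\<close>

context koiter_tube
begin

abbreviation I where "I \<equiv> {0..sbar}"
abbreviation J where "J \<equiv> {0..ell}"

lemma C_pos: "0 < C" and D_pos: "0 < D" and nu2: "0 < 1 - nu\<^sup>2"
proof -
  show *: "0 < 1 - nu\<^sup>2"
    using nu_bounds by (simp add: abs_square_less_1 abs_less_iff)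
  show "0 < C" "0 < D"
    unfolding C_def D_def using * E_pos h_pos by simp_all
qed

lemma C_D_nz [simp]: "C \<noteq> 0" "D \<noteq> 0"
  using C_pos D_pos by simp_all

lemma nu_ne_1 [simp]: "nu \<noteq> 1" "1 \<noteq> nu"
  using nu_bounds by auto

lemma r0_eq: "r0 s = lift (x s)" and rhat_eq: "rhat s = lift (x s) + sbar *\<^sub>R e3"
  and tau_eq: "tau s = lift (dx s)" and nrm_eq: "nrm s = cross3 (tau s) e3"
  by (simp_all add: r0_def r_def rhat_def tau_def nrm_def lift_def)
    (simp add: sum_2 vec_eq_iff forall_3 cross3_simps alt_def)

lemma r0_3 [simp]: "r0 s $ 3 = 0" and rhat_3 [simp]: "rhat s $ 3 = sbar"
  and tau_3 [simp]: "tau s $ 3 = 0" and nrm_3 [simp]: "nrm s $ 3 = 0"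
  by (simp_all add: r0_eq rhat_eq tau_eq nrm_eq cross3_simps)

lemma x_deriv: "s \<in> I \<Longrightarrow> (x has_vector_derivative dx s) (at s within I)"
  and dx_deriv: "s \<in> I \<Longrightarrow> (dx has_vector_derivative ddx s) (at s within I)"
  and dx_unit: "s \<in> I \<Longrightarrow> dx s \<bullet> dx s = 1"
  and ddx_cont: "continuous_on I ddx"
  and x_closed: "x 0 = x sbar" and dx_closed: "dx 0 = dx sbar" and ddx_closed: "ddx 0 = ddx sbar"
  using curve D_on_works[of x sbar s] D_on_works[of dx sbar s]
  unfolding closed_C2_curve_def dx_def ddx_def by (simp_all add: dot_square_norm)

lemma dx_orth_ddx:
  assumes "s \<in> I" shows "dx s \<bullet> ddx s = 0"
proof -
  have "((\<lambda>t. dx t \<bullet> dx t) has_vector_derivative (dx s \<bullet> ddx s + ddx s \<bullet> dx s)) (at s within I)"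
    using has_real_derivative_inner[OF dx_deriv dx_deriv] assms
    by (simp add: has_real_derivative_iff_has_vector_derivative)
  moreover have "((\<lambda>t. dx t \<bullet> dx t) has_vector_derivative 0) (at s within I)"
    by (rule has_vector_derivative_transform[OF assms, of _ "\<lambda>_. 1"]) (simp_all add: dx_unit)
  ultimately have "dx s \<bullet> ddx s + ddx s \<bullet> dx s = 0"
    by (rule has_vector_derivative_unique_on[OF sbar_pos assms])
  then show ?thesis by (simp add: inner_commute)
qed

lemma kappa_eq: "kappa s = dx s $ 1 * ddx s $ 2 - dx s $ 2 * ddx s $ 1"
  by (simp add: kappa_def sum_2 alt_def)

text \<open>Since the curve has unit speed, \<open>\<tau>'\<close> is orthogonal to \<open>\<tau>\<close>, hence a multiple of \<open>n\<close>; the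
  factor is \<open>- 1/R\<close> by definition of the curvature.\<close>

lemma tau_deriv_eq:
  assumes "s \<in> I" shows "lift (ddx s) = - kappa s *\<^sub>R nrm s"
proof -
  have 1: "dx s $ 1 * dx s $ 1 + dx s $ 2 * dx s $ 2 = 1"
    and 2: "dx s $ 1 * ddx s $ 1 + dx s $ 2 * ddx s $ 2 = 0"
    using dx_unit[OF assms] dx_orth_ddx[OF assms] by (simp_all add: inner_vec_def sum_2)
  show ?thesis
    unfolding vec_eq_iff forall_3 nrm_eq tau_eq kappa_eq using 1 2
    by (simp add: cross3_def vector_def) algebra
qed

lemma r0_deriv: "s \<in> I \<Longrightarrow> (r0 has_vector_derivative tau s) (at s within I)"
  unfolding r0_eq[abs_def] tau_eq
  by (rule bounded_linear.has_vector_derivative[OF bounded_linear_lift x_deriv])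

lemma rhat_deriv: "s \<in> I \<Longrightarrow> (rhat has_vector_derivative tau s) (at s within I)"
  using has_vector_derivative_add[OF r0_deriv has_vector_derivative_const, of s "sbar *\<^sub>R e3"]
  by (simp add: r0_eq[abs_def] rhat_eq[abs_def])

lemma tau_deriv: "s \<in> I \<Longrightarrow> (tau has_vector_derivative - kappa s *\<^sub>R nrm s) (at s within I)"
  unfolding tau_deriv_eq[symmetric] tau_eq[abs_def]
  by (rule bounded_linear.has_vector_derivative[OF bounded_linear_lift dx_deriv])

lemma frame_inner:
  assumes "s \<in> I"
  shows "tau s \<bullet> tau s = 1" "nrm s \<bullet> nrm s = 1" "tau s \<bullet> nrm s = 0" "nrm s \<bullet> tau s = 0"
  using dx_unit[OF assms] by (auto simp: nrm_eq tau_eq inner_vec_def sum_3 sum_2 cross3_simps)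

lemma cross_nrm_e3: "cross3 (nrm s) e3 = - tau s"
  by (simp add: nrm_eq tau_eq vec_eq_iff forall_3 cross3_simps)

lemma nrm_deriv: "s \<in> I \<Longrightarrow> (nrm has_vector_derivative kappa s *\<^sub>R tau s) (at s within I)"
  using has_vector_derivative_cross3_const[OF tau_deriv, of s e3]
  by (simp add: nrm_eq[abs_def, symmetric] cross_mult_left cross_nrm_e3)

lemma frame_expand:
  assumes "s \<in> I"
  shows "v = (v \<bullet> tau s) *\<^sub>R tau s + (v \<bullet> nrm s) *\<^sub>R nrm s + v $ 3 *\<^sub>R e3"
proof -
  have 1: "dx s $ 1 * dx s $ 1 + dx s $ 2 * dx s $ 2 = 1"
    using dx_unit[OF assms] by (simp add: inner_vec_def sum_2)
  show ?thesis
    unfolding vec_eq_iff forall_3 nrm_eq tau_eq using 1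
    by (simp add: cross3_def vector_def inner_vec_def sum_3) algebra
qed

lemma deriv_cont:
  "(\<And>s. s \<in> I \<Longrightarrow> (g has_vector_derivative g' s) (at s within I)) \<Longrightarrow> continuous_on I g"
  by (meson continuous_on_eq_continuous_within has_vector_derivative_continuous)

lemma frame_cont [continuous_intros]:
  "continuous_on I x" "continuous_on I dx"
  "continuous_on I r0" "continuous_on I rhat" "continuous_on I tau" "continuous_on I nrm"
  using deriv_cont[of x, OF x_deriv] deriv_cont[of dx, OF dx_deriv]
    deriv_cont[of r0, OF r0_deriv] deriv_cont[of rhat, OF rhat_deriv]
    deriv_cont[of tau, OF tau_deriv] deriv_cont[of nrm, OF nrm_deriv] by simp_all

lemma kappa_cont [continuous_intros]: "continuous_on I kappa"
  unfolding kappa_eq[abs_def] by (intro continuous_intros ddx_cont)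

lemma cmpl_cont [continuous_intros]: "continuous_on I cmpl"
  unfolding cmpl_def[abs_def] using C_pos D_pos by (intro continuous_intros) auto

section \<open>The linear systems for the constant vectors\<close>

text \<open>The rates that recur in all formulas below: \<open>axial\<close> is the derivative of \<open>Q\<close> and the stress
  \<open>P_zz\<close> per unit of \<open>z\<close>, \<open>bend\<close> is the derivative of \<open>F\<close>, and \<open>- couple\<close> is the bending moment
  \<open>M_zz\<close> per unit of \<open>z\<close>.\<close>

definition axial where
  "axial A B s = C * (1 - nu\<^sup>2) * (A \<bullet> rhat s) - nu * (B \<bullet> (nrm s + kappa s *\<^sub>R rhat s))"
definition bend where
  "bend A B s = ((nu * kappa s) *\<^sub>R A + cmpl s *\<^sub>R B) \<bullet> rhat s"
definition couple where
  "couple A B s = D * (1 - nu\<^sup>2) * (A \<bullet> nrm s) + nu * (B \<bullet> rhat s)"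

lemma rates_cont [continuous_intros]:
  "continuous_on I (axial A B)" "continuous_on I (bend A B)" "continuous_on I (couple A B)"
  unfolding axial_def[abs_def] bend_def[abs_def] couple_def[abs_def]
  by (intro continuous_intros)+

lemma integral_of_periodic_derivative:
  fixes g :: "real \<Rightarrow> 'a::euclidean_space"
  assumes "\<And>s. s \<in> I \<Longrightarrow> (g has_vector_derivative g' s) (at s within I)" "g 0 = g sbar"
  shows "(g' has_integral 0) I"
  using fundamental_theorem_of_calculus[of 0 sbar g g'] assms sbar_pos by simp

lemma geometry_closed:
  "r0 sbar = r0 0" "rhat sbar = rhat 0" "tau sbar = tau 0" "nrm sbar = nrm 0"
  "kappa sbar = kappa 0" "cmpl sbar = cmpl 0"
  by (simp_all add: r0_eq rhat_eq tau_eq nrm_eq kappa_eq cmpl_def x_closed dx_closed ddx_closed)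

text \<open>The two systems in vector form. The vector \<open>edge_load A B\<close> will turn out to be the integral of
  the edge force, and \<open>seam_gap A B\<close> measures the failure of the displacement to close up after one
  turn around the cross-section.\<close>

definition edge_load where
  "edge_load A B = integral I (\<lambda>s. axial A B s *\<^sub>R rhat s + couple A B s *\<^sub>R nrm s)"
definition seam_gap where
  "seam_gap A B = integral I (\<lambda>s. bend A B s *\<^sub>R rhat s +
     (1 / C) *\<^sub>R (transv B + (B \<bullet> tau s) *\<^sub>R tau s))"

lemma edge_load_seam_gap_cont [continuous_intros]:
  "continuous_on I (\<lambda>s. axial A B s *\<^sub>R rhat s + couple A B s *\<^sub>R nrm s)"
  "continuous_on I (\<lambda>s. bend A B s *\<^sub>R rhat s +
     (1 / C) *\<^sub>R (transv B + (B \<bullet> tau s) *\<^sub>R tau s))"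
  by (intro continuous_intros)+

lemma edge_load_seam_gap_component:
  "edge_load A B $ i = integral I (\<lambda>s. (axial A B s *\<^sub>R rhat s + couple A B s *\<^sub>R nrm s) $ i)"
  "seam_gap A B $ i = integral I (\<lambda>s. (bend A B s *\<^sub>R rhat s +
     (1 / C) *\<^sub>R (transv B + (B \<bullet> tau s) *\<^sub>R tau s)) $ i)"
  unfolding edge_load_def seam_gap_def
  by (intro integral_component_eq_cart[symmetric] integrable_continuous_real continuous_intros)+

lemma F_eq: "F A B s = integral {0..s} (bend A B)"
  by (simp add: F_def bend_def[abs_def])

lemma Q_eq: "Q A B s = integral {0..s} (axial A B)"
  by (simp add: Q_def axial_def[abs_def])

text \<open>Since \<open>rhat\<close> has the constant axial component \<open>sbar\<close>, the axial components record the increments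
  of \<open>Q\<close> and \<open>F\<close> over one turn.\<close>

lemma edge_load_3: "edge_load A B $ 3 = sbar * Q A B sbar"
  and seam_gap_3: "seam_gap A B $ 3 = sbar * F A B sbar"
  by (simp_all add: edge_load_seam_gap_component Q_eq F_eq mult.commute)

lemma combine_integrals:
  fixes v w :: "real \<Rightarrow> real ^ 3"
  assumes "continuous_on I v" "continuous_on I w"
  shows "c * (A \<bullet> integral I v) + d * (B \<bullet> integral I w)
    = integral I (\<lambda>s. c * (A \<bullet> v s) + d * (B \<bullet> w s))"
proof -
  have "v integrable_on I" "w integrable_on I"
    using assms by (auto intro: integrable_continuous_real)
  moreover have "(\<lambda>s. c * (A \<bullet> v s)) integrable_on I" "(\<lambda>s. d * (B \<bullet> w s)) integrable_on I"
    using assms by (auto intro!: integrable_continuous_real continuous_intros)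
  ultimately show ?thesis
    by (simp add: inner_integral integral_add)
qed

lemma B_system_iff: "B_system A B \<longleftrightarrow> seam_gap A B = 0"
proof -
  have 1: "nu * (A \<bullet> integral I (\<lambda>s. kappa s *\<^sub>R rhat s)) +
       B \<bullet> integral I (\<lambda>s. cmpl s *\<^sub>R rhat s) = integral I (bend A B)"
    by (subst combine_integrals[where d=1, simplified])
      (auto intro!: continuous_intros integral_cong simp: bend_def inner_add_left)
  have 2: "seam_gap A B $ 3 = sbar * integral I (bend A B)"
    by (simp add: seam_gap_3 F_eq)
  have 3: "nu * (A \<bullet> integral I (\<lambda>s. (x s $ \<alpha> * kappa s) *\<^sub>R rhat s)) +
       B \<bullet> integral I (\<lambda>s. (x s $ \<alpha> * cmpl s) *\<^sub>R rhat s + (1 / C) *\<^sub>R (ee \<alpha> + dx s $ \<alpha> *\<^sub>R tau s))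
     = integral I (\<lambda>s. bend A B s * x s $ \<alpha> + (1 / C) * (B \<bullet> ee \<alpha> + (B \<bullet> tau s) * dx s $ \<alpha>))" for \<alpha>
    by (subst combine_integrals[where d=1, simplified])
      (auto intro!: continuous_intros integral_cong simp: bend_def algebra_simps inner_add_left inner_add_right)
  have 4: "seam_gap A B $ 1 = integral I (\<lambda>s. bend A B s * x s $ 1 + (1 / C) * (B \<bullet> ee 1 + (B \<bullet> tau s) * dx s $ 1))"
     "seam_gap A B $ 2 = integral I (\<lambda>s. bend A B s * x s $ 2 + (1 / C) * (B \<bullet> ee 2 + (B \<bullet> tau s) * dx s $ 2))"
    unfolding edge_load_seam_gap_component by (auto intro!: integral_cong simp: rhat_eq tau_eq inner_vec_def sum_3)
  show ?thesis
    unfolding B_system_def 1 3 using sbar_pos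
    by (auto simp: vec_eq_iff[of "seam_gap A B"] forall_3 forall_2 2 4)
qed

text \<open>The normal is the derivative of the periodic function \<open>r \<times> e\<^sub>3\<close>.\<close>

lemma integral_nrm: "integral I (\<lambda>s. v \<bullet> nrm s) = 0"
proof -
  have "((\<lambda>s. v \<bullet> cross3 (r0 s) e3) has_vector_derivative v \<bullet> nrm s) (at s within I)" if "s \<in> I" for s
    using bounded_linear.has_vector_derivative[OF bounded_linear_inner_right
        has_vector_derivative_cross3_const[OF r0_deriv[OF that]]]
    by (simp add: nrm_eq)
  then show ?thesis
    by (intro integral_unique integral_of_periodic_derivative[where g = "\<lambda>s. v \<bullet> cross3 (r0 s) e3"])
      (auto simp: geometry_closed)
qed

text \<open>The first equation of the system has no counterpart of the summand \<open>- \<nu> B \<bullet> n\<close> of \<open>axial\<close>; the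
  difference integrates to zero.\<close>

lemma A_system_iff: "A_system R0 A B \<longleftrightarrow> edge_load A B = - lift R0"
proof -
  have 1: "C * (1 - nu\<^sup>2) * (A \<bullet> integral I rhat) - nu * (B \<bullet> integral I (\<lambda>s. kappa s *\<^sub>R rhat s))
    = integral I (axial A B)"
  proof -
    have "integral I (axial A B) = integral I (\<lambda>s. C * (1 - nu\<^sup>2) * (A \<bullet> rhat s) - nu * (B \<bullet> (kappa s *\<^sub>R rhat s)))
        - integral I (\<lambda>s. nu * (B \<bullet> nrm s))"
      by (subst integral_diff[symmetric])
        (auto intro!: integrable_continuous_real continuous_intros integral_cong simp: axial_def inner_add_right algebra_simps)
    then show ?thesis
      using combine_integrals[of rhat "\<lambda>s. kappa s *\<^sub>R rhat s" "C * (1 - nu\<^sup>2)" A "- nu" B]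
      by (simp add: integral_nrm continuous_intros)
  qed
  have 2: "edge_load A B $ 3 = sbar * integral I (axial A B)"
    by (simp add: edge_load_3 Q_eq)
  have 3: "C * (1 - nu\<^sup>2) *
         (A \<bullet> integral I (\<lambda>s. x s $ \<alpha> *\<^sub>R rhat s + (D / C * (\<Sum>\<beta>\<in>UNIV. alt \<alpha> \<beta> * dx s $ \<beta>)) *\<^sub>R nrm s)) -
       nu * (B \<bullet> integral I (\<lambda>s. x s $ \<alpha> *\<^sub>R (kappa s *\<^sub>R rhat s + nrm s) -
             (\<Sum>\<beta>\<in>UNIV. alt \<alpha> \<beta> * dx s $ \<beta>) *\<^sub>R rhat s))
     = integral I (\<lambda>s. axial A B s * x s $ \<alpha> + couple A B s * (\<Sum>\<beta>\<in>UNIV. alt \<alpha> \<beta> * dx s $ \<beta>))" (is "?l = ?r") for \<alpha>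
  proof -
    let ?v = "\<lambda>s. x s $ \<alpha> *\<^sub>R rhat s + (D / C * (\<Sum>\<beta>\<in>UNIV. alt \<alpha> \<beta> * dx s $ \<beta>)) *\<^sub>R nrm s"
    let ?w = "\<lambda>s. x s $ \<alpha> *\<^sub>R (kappa s *\<^sub>R rhat s + nrm s) - (\<Sum>\<beta>\<in>UNIV. alt \<alpha> \<beta> * dx s $ \<beta>) *\<^sub>R rhat s"
    have "continuous_on I ?v" "continuous_on I ?w"
      using C_pos by (auto intro!: continuous_intros)
    from combine_integrals[OF this, of "C * (1 - nu\<^sup>2)" A "- nu" B]
    have "?l = integral I (\<lambda>s. C * (1 - nu\<^sup>2) * (A \<bullet> ?v s) + - nu * (B \<bullet> ?w s))"
      by simp
    also have "\<dots> = ?r"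
      using C_pos
      by (intro integral_cong) (simp add: axial_def couple_def inner_add_right inner_diff_right field_simps)
    finally show ?thesis .
  qed
  have 4: "edge_load A B $ 1 = integral I (\<lambda>s. axial A B s * x s $ 1 + couple A B s * (\<Sum>\<beta>\<in>UNIV. alt 1 \<beta> * dx s $ \<beta>))"
     "edge_load A B $ 2 = integral I (\<lambda>s. axial A B s * x s $ 2 + couple A B s * (\<Sum>\<beta>\<in>UNIV. alt 2 \<beta> * dx s $ \<beta>))"
    unfolding edge_load_seam_gap_component by (auto intro!: integral_cong simp: rhat_eq nrm_eq tau_eq sum_2 alt_def cross3_simps)
  show ?thesis
    unfolding A_system_def 1 3 using sbar_pos
    by (auto simp: vec_eq_iff[of "edge_load A B"] forall_3 forall_2 2 4)
qed

lemma edge_load_seam_gap_linear: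
  "linear (\<lambda>p. (edge_load (fst p) (snd p), seam_gap (fst p) (snd p)))"
proof (rule linearI)
  have add: "axial (A + A') (B + B') s = axial A B s + axial A' B' s"
    "couple (A + A') (B + B') s = couple A B s + couple A' B' s"
    "bend (A + A') (B + B') s = bend A B s + bend A' B' s"
    "transv (B + B') = transv B + transv B'" for A A' B B' s
    by (simp_all add: axial_def couple_def bend_def transv_def algebra_simps inner_add_left inner_add_right)
  have scale: "axial (c *\<^sub>R A) (c *\<^sub>R B) s = c * axial A B s"
    "couple (c *\<^sub>R A) (c *\<^sub>R B) s = c * couple A B s"
    "bend (c *\<^sub>R A) (c *\<^sub>R B) s = c * bend A B s"
    "transv (c *\<^sub>R B) = c *\<^sub>R transv B" for A B c s
    by (simp_all add: axial_def couple_def bend_def transv_def algebra_simps inner_add_left inner_add_right)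
  note ic = integrable_continuous_real
  fix p p' :: "(real^3) \<times> (real^3)" and c :: real
  obtain A B A' B' where [simp]: "p = (A, B)" "p' = (A', B')" by fastforce
  have "edge_load (A + A') (B + B') = edge_load A B + edge_load A' B'"
    "seam_gap (A + A') (B + B') = seam_gap A B + seam_gap A' B'"
    unfolding edge_load_def seam_gap_def
    by (subst integral_add[symmetric];
        (intro ic continuous_intros)?; simp add: add inner_add_left scaleR_add_left scaleR_add_right algebra_simps)+
  then show "(edge_load (fst (p + p')) (snd (p + p')), seam_gap (fst (p + p')) (snd (p + p')))
      = (edge_load (fst p) (snd p), seam_gap (fst p) (snd p)) + (edge_load (fst p') (snd p'), seam_gap (fst p') (snd p'))"
    by simp
  have "edge_load (c *\<^sub>R A) (c *\<^sub>R B) = c *\<^sub>R edge_load A B"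
    "seam_gap (c *\<^sub>R A) (c *\<^sub>R B) = c *\<^sub>R seam_gap A B"
    unfolding edge_load_def seam_gap_def
    by (subst integral_cmul[symmetric]; simp add: scale algebra_simps)+
  then show "(edge_load (fst (c *\<^sub>R p)) (snd (c *\<^sub>R p)), seam_gap (fst (c *\<^sub>R p)) (snd (c *\<^sub>R p)))
      = c *\<^sub>R (edge_load (fst p) (snd p), seam_gap (fst p) (snd p))"
    by simp
qed

text \<open>The part of the integrand that comes from the position in the cross-section is
  \<open>(A \<times> B)\<^sub>3\<close> times \<open>- r \<bullet> \<tau>\<close>, the derivative of \<open>- |r|\<^sup>2/2\<close>; the part from the constant axial
  component of \<open>rhat\<close> is a constant vector times the derivative of \<open>r \<times> e\<^sub>3\<close>. Both antiderivatives are
  periodic.\<close>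

lemma cross_terms_cancel:
  "((\<lambda>s. (A \<bullet> rhat s) * (B \<bullet> nrm s) - (B \<bullet> rhat s) * (A \<bullet> nrm s)) has_integral 0) I"
proof (rule integral_of_periodic_derivative)
  let ?g = "\<lambda>s. (A $ 2 * B $ 1 - A $ 1 * B $ 2) / 2 * (r0 s \<bullet> r0 s)
    + sbar * ((A $ 3 *\<^sub>R B - B $ 3 *\<^sub>R A) \<bullet> cross3 (r0 s) e3)"
  show "?g 0 = ?g sbar"
    by (simp add: geometry_closed)
  fix s assume s: "s \<in> I"
  note [derivative_intros] = has_real_derivative_inner[OF r0_deriv[OF s] r0_deriv[OF s]]
    has_real_derivative_inner[OF has_vector_derivative_const has_vector_derivative_cross3_const[OF r0_deriv[OF s]]]
  have "(?g has_real_derivative (A $ 2 * B $ 1 - A $ 1 * B $ 2) * (r0 s \<bullet> tau s)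
    + sbar * ((A $ 3 *\<^sub>R B - B $ 3 *\<^sub>R A) \<bullet> nrm s)) (at s within I)"
    by (rule derivative_eq_intros refl | simp)+ (simp add: nrm_eq inner_commute)
  also have "(A $ 2 * B $ 1 - A $ 1 * B $ 2) * (r0 s \<bullet> tau s)
    + sbar * ((A $ 3 *\<^sub>R B - B $ 3 *\<^sub>R A) \<bullet> nrm s)
    = (A \<bullet> rhat s) * (B \<bullet> nrm s) - (B \<bullet> rhat s) * (A \<bullet> nrm s)"
    by (simp add: r0_eq rhat_eq tau_eq nrm_eq inner_vec_def sum_3 cross3_def vector_def algebra_simps)
  finally show "(?g has_vector_derivative
    (A \<bullet> rhat s) * (B \<bullet> nrm s) - (B \<bullet> rhat s) * (A \<bullet> nrm s)) (at s within I)"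
    by (simp add: has_real_derivative_iff_has_vector_derivative)
qed

text \<open>Up to terms that integrate to zero, the density of the work of \<open>(edge_load A B, seam_gap A B)\<close>
  on \<open>(A, B)\<close>: a sum of squares with positive coefficients.\<close>

definition energy where
  "energy A B s = C * (1 - nu\<^sup>2) * (A \<bullet> rhat s)\<^sup>2 + D * (1 - nu\<^sup>2) * (A \<bullet> nrm s)\<^sup>2
     + cmpl s * (B \<bullet> rhat s)\<^sup>2 + (transv B \<bullet> transv B + (B \<bullet> tau s)\<^sup>2) / C"

lemma energy_cont [continuous_intros]: "continuous_on I (energy A B)"
  unfolding energy_def[abs_def] by (auto intro!: continuous_intros)

text \<open>The products \<open>\<nu> \<kappa> a b\<close> occur with opposite signs in the two terms and cancel pointwise; what
  remains besides the energy is the integrand of \<open>cross_terms_cancel\<close>.\<close>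

lemma edge_load_seam_gap_work: "A \<bullet> edge_load A B + B \<bullet> seam_gap A B = integral I (energy A B)"
proof -
  let ?c = "\<lambda>s. (A \<bullet> rhat s) * (B \<bullet> nrm s) - (B \<bullet> rhat s) * (A \<bullet> nrm s)"
  have "A \<bullet> edge_load A B + B \<bullet> seam_gap A B
    = integral I (\<lambda>s. A \<bullet> (axial A B s *\<^sub>R rhat s + couple A B s *\<^sub>R nrm s)
        + B \<bullet> (bend A B s *\<^sub>R rhat s + (1 / C) *\<^sub>R (transv B + (B \<bullet> tau s) *\<^sub>R tau s)))"
    unfolding edge_load_def seam_gap_def
    using combine_integrals[OF edge_load_seam_gap_cont, where c = 1 and d = 1] by simp
  also have "\<dots> = integral I (\<lambda>s. energy A B s - nu * ?c s)"
    by (intro integral_cong)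
      (simp add: axial_def couple_def bend_def energy_def transv_def inner_add_right inner_add_left
        inner_diff_left inner_diff_right algebra_simps power2_eq_square add_divide_distrib diff_divide_distrib)
  also have "\<dots> = integral I (energy A B) - integral I (\<lambda>s. nu * ?c s)"
    by (intro integral_diff integrable_continuous_real continuous_intros)
  also have "integral I (\<lambda>s. nu * ?c s) = 0"
    using cross_terms_cancel[of A B] by (simp add: integral_unique)
  finally show ?thesis by simp
qed

lemma cmpl_pos: "0 < cmpl s"
  unfolding cmpl_def using C_pos D_pos by (intro add_pos_nonneg) auto

text \<open>The disjunction covers both uses: with \<open>edge_load A B = 0\<close> it gives the injectivity of the joint
  operator, with \<open>A = 0\<close> that of \<open>B \<mapsto> seam_gap 0 B\<close>. In both cases the energy vanishes
  identically. Then \<open>b\<close> and the transverse part of \<open>B\<close> vanish, so \<open>B = 0\<close>; moreover \<open>a\<close>, hence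
  its derivative \<open>A \<bullet> \<tau>\<close>, and \<open>A \<bullet> n\<close> vanish, so \<open>A\<close> is axial and then zero because \<open>a = 0\<close>.\<close>

lemma edge_load_seam_gap_injective:
  assumes "edge_load A B = 0 \<or> A = 0" "seam_gap A B = 0"
  shows "A = 0" "B = 0"
proof -
  have nonneg: "0 \<le> C * (1 - nu\<^sup>2) * (A \<bullet> rhat s)\<^sup>2" "0 \<le> D * (1 - nu\<^sup>2) * (A \<bullet> nrm s)\<^sup>2"
    "0 \<le> cmpl s * (B \<bullet> rhat s)\<^sup>2" "0 \<le> (B \<bullet> tau s)\<^sup>2 / C" for s
    using C_pos D_pos nu2 cmpl_pos[of s] by simp_all
  have nonneg': "0 \<le> transv B \<bullet> transv B / C"
    using C_pos by simp
  have energy_nonneg: "0 \<le> energy A B s" for s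
    unfolding energy_def add_divide_distrib by (intro add_nonneg_nonneg nonneg nonneg')
  have "integral I (energy A B) = 0"
    using assms edge_load_seam_gap_work[of A B] by auto
  then have "(energy A B has_integral 0) I"
    by (metis energy_cont integrable_continuous_real integrable_integral)
  then have "energy A B s = 0" if "s \<in> I" for s
    using has_integral_0_cbox_imp_0[of 0 sbar "energy A B" s] that sbar_pos energy_nonneg energy_cont
    by auto
  then have zero: "C * (1 - nu\<^sup>2) * (A \<bullet> rhat s)\<^sup>2 = 0" "D * (1 - nu\<^sup>2) * (A \<bullet> nrm s)\<^sup>2 = 0"
    "cmpl s * (B \<bullet> rhat s)\<^sup>2 = 0" "transv B \<bullet> transv B / C = 0" if "s \<in> I" for s
    using that nonneg[of s] nonneg' unfolding energy_def add_divide_distrib by (smt (verit))+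
  have a0: "A \<bullet> rhat s = 0" and n0: "A \<bullet> nrm s = 0" and b0: "B \<bullet> rhat s = 0"
    and B0: "transv B = 0" if "s \<in> I" for s
    using zero[OF that] nu2 cmpl_pos[of s] by auto
  have 0: "0 \<in> I" using sbar_pos by simp
  \<comment> \<open>A vector without transverse part is axial, and \<open>rhat\<close> has the positive axial component \<open>sbar\<close>.\<close>
  have trans0: "v = 0" if "transv v = 0" "v \<bullet> rhat 0 = 0" for v
  proof -
    have *: "v = v $ 3 *\<^sub>R e3"
      using that(1) by (simp add: transv_def)
    have "v \<bullet> rhat 0 = v $ 3 * sbar"
      by (subst *) simp
    then show "v = 0"
      using * that(2) sbar_pos by simp
  qed
  show "B = 0" by (rule trans0[OF B0[OF 0] b0[OF 0]])
  have "((\<lambda>s. A \<bullet> rhat s) has_vector_derivative A \<bullet> tau 0) (at 0 within I)"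
    by (rule bounded_linear.has_vector_derivative[OF bounded_linear_inner_right rhat_deriv[OF 0]])
  moreover have "((\<lambda>s. A \<bullet> rhat s) has_vector_derivative 0) (at 0 within I)"
    by (rule has_vector_derivative_transform[OF 0, of _ "\<lambda>_. 0"]) (simp_all add: a0)
  ultimately have "A \<bullet> tau 0 = 0"
    by (rule has_vector_derivative_unique_on[OF sbar_pos 0])
  then have "A = A $ 3 *\<^sub>R e3"
    using frame_expand[OF 0, of A] n0[OF 0] by simp
  then show "A = 0"
    by (intro trans0[OF _ a0[OF 0]]) (simp add: transv_def)
qed

lemma B_system_unique_solution: "\<exists>!B. B_system A B"
proof -
  have add: "seam_gap (A1 + A2) (B1 + B2) = seam_gap A1 B1 + seam_gap A2 B2" for A1 A2 B1 B2
    using linear_add[OF edge_load_seam_gap_linear, of "(A1, B1)" "(A2, B2)"] by simp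
  have scale: "seam_gap 0 (c *\<^sub>R B) = c *\<^sub>R seam_gap 0 B" for c B
    using linear_scale[OF edge_load_seam_gap_linear, of c "(0, B)"] by simp
  have lin: "linear (seam_gap 0)"
    using add[of 0 0] scale by (intro linearI) simp_all
  moreover have "inj (seam_gap 0)"
    using edge_load_seam_gap_injective(2)[of 0] by (auto simp: linear_injective_0[OF lin])
  ultimately have "bij (seam_gap 0)"
    by (simp add: bij_def linear_injective_imp_surjective)
  then have "\<exists>!B. seam_gap 0 B = - seam_gap A 0"
    unfolding bij_iff by blast
  moreover have "B_system A B \<longleftrightarrow> seam_gap 0 B = - seam_gap A 0" for B
    using add[of 0 A B 0] by (simp add: B_system_iff eq_neg_iff_add_eq_0)
  ultimately show ?thesis
    by simp
qed

text \<open>The systems for \<open>A\<close> and \<open>B\<close> are solved jointly, as one system with six unknowns.\<close>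

lemma A_system_unique_solution: "\<exists>!A. \<exists>B. B_system A B \<and> A_system R0 A B"
proof -
  define L where "L p = (edge_load (fst p) (snd p), seam_gap (fst p) (snd p))" for p
  have lin: "linear L"
    using edge_load_seam_gap_linear by (simp add: L_def[abs_def])
  have "p = 0" if "L p = 0" for p
  proof -
    have "edge_load (fst p) (snd p) = 0 \<or> fst p = 0" "seam_gap (fst p) (snd p) = 0"
      using that by (simp_all add: L_def zero_prod_def)
    then have "fst p = 0" "snd p = 0"
      by (rule edge_load_seam_gap_injective)+
    then show ?thesis
      by (simp add: prod_eq_iff)
  qed
  then have inj: "inj L"
    by (simp add: linear_injective_0[OF lin])
  then have "surj L"
    by (rule linear_injective_imp_surjective[OF lin]) simp
  then obtain p where p: "L p = (- lift R0, 0)"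
    by (metis surjD)
  show ?thesis
    unfolding A_system_iff B_system_iff
  proof (intro ex1I exI)
    show "seam_gap (fst p) (snd p) = 0 \<and> edge_load (fst p) (snd p) = - lift R0"
      using p by (simp add: L_def)
    fix A' assume "\<exists>B. seam_gap A' B = 0 \<and> edge_load A' B = - lift R0"
    then obtain B' where B': "seam_gap A' B' = 0" "edge_load A' B' = - lift R0"
      by blast
    have "L (A', B') = L p"
      using B' p by (simp add: L_def)
    then have "(A', B') = p"
      by (rule injD[OF inj])
    then show "A' = fst p"
      by auto
  qed
qed

section \<open>Calculus of the fields in the solution\<close>

text \<open>These are the fields in the strains of the solution: the hoop strain is \<open>- z hoop\<close>, the twist
  \<open>\<rho>_sz\<close> is \<open>twist\<close>, and \<open>2 \<epsilon>_sz\<close> is \<open>shear\<close>. The fields \<open>planar\<close> and \<open>warp\<close> are the coefficient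
  of \<open>z\<close> and the axial displacement at \<open>z = 0\<close>.\<close>

definition hoop where
  "hoop A B s = nu * (A \<bullet> rhat s) + (B \<bullet> nrm s + kappa s * (B \<bullet> rhat s)) / C"
definition twist where
  "twist A B K s = nu * (A \<bullet> cross3 (r0 s) e3) - K + (B \<bullet> tau s) / C - F A B s"
definition shear where
  "shear A B K s = 2 * K * area / sbar + K0 A B - 2 / (C * (1 - nu)) * Q A B s"
definition planar where
  "planar A B K s = (nu / 2 * (r0 s \<bullet> r0 s)) *\<^sub>R transv A - (nu * (A \<bullet> rhat s)) *\<^sub>R r0 s
     - K *\<^sub>R cross3 (r0 s) e3 + W A B s"
definition warp where
  "warp A B K s = K * phi s + psi A B s"

lemma cross3_e3_frame:
  assumes "s \<in> I"
  shows "cross3 v e3 = - (v \<bullet> nrm s) *\<^sub>R tau s + (v \<bullet> tau s) *\<^sub>R nrm s"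
proof -
  have "cross3 v e3 \<bullet> tau s = - (v \<bullet> nrm s)" "cross3 v e3 \<bullet> nrm s = v \<bullet> tau s" "cross3 v e3 $ 3 = 0"
    by (simp_all add: nrm_eq tau_eq inner_vec_def sum_3 cross3_def vector_def)
  then show ?thesis
    using frame_expand[OF assms, of "cross3 v e3"] by simp
qed

lemma frame_eqI:
  assumes "s \<in> I" "v \<bullet> tau s = w \<bullet> tau s" "v \<bullet> nrm s = w \<bullet> nrm s" "v $ 3 = w $ 3"
  shows "v = w"
  using frame_expand[OF assms(1), of v] frame_expand[OF assms(1), of w] assms(2-) by simp

lemma has_real_derivative_integral:
  "continuous_on I g \<Longrightarrow> s \<in> I \<Longrightarrow>
    ((\<lambda>s. integral {0..s} g) has_real_derivative g s) (at s within I)"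
  by (simp add: has_real_derivative_iff_has_vector_derivative integral_has_vector_derivative)

lemma F_deriv: "s \<in> I \<Longrightarrow> (F A B has_real_derivative bend A B s) (at s within I)"
  unfolding F_eq[abs_def] by (intro has_real_derivative_integral continuous_intros)

lemma Q_deriv: "s \<in> I \<Longrightarrow> (Q A B has_real_derivative axial A B s) (at s within I)"
  unfolding Q_eq[abs_def] by (intro has_real_derivative_integral continuous_intros)

lemma F_Q_cont [continuous_intros]: "continuous_on I (F A B)" "continuous_on I (Q A B)"
  by (meson DERIV_continuous_on F_deriv Q_deriv)+

lemma W_deriv:
  assumes "s \<in> I"
  shows "(W A B has_vector_derivative
    (- (B \<bullet> nrm s + kappa s * (B \<bullet> rhat s)) / C) *\<^sub>R tau s + ((B \<bullet> tau s) / C - F A B s) *\<^sub>R nrm s)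
    (at s within I)"
proof -
  have 1: "((\<lambda>s. integral {0..s} (\<lambda>s. (kappa s * (B \<bullet> rhat s)) *\<^sub>R tau s)) has_vector_derivative
      (kappa s * (B \<bullet> rhat s)) *\<^sub>R tau s) (at s within I)"
    by (rule integral_has_vector_derivative[OF _ assms]) (intro continuous_intros)
  have 2: "((\<lambda>s. integral {0..s} (\<lambda>s. F A B s *\<^sub>R nrm s)) has_vector_derivative F A B s *\<^sub>R nrm s)
      (at s within I)"
    by (rule integral_has_vector_derivative[OF _ assms]) (intro continuous_intros)
  have "(W A B has_vector_derivative
    (1 / C) *\<^sub>R (cross3 B e3 - (kappa s * (B \<bullet> rhat s)) *\<^sub>R tau s) - F A B s *\<^sub>R nrm s) (at s within I)"
    unfolding W_def[abs_def]
    by (rule derivative_eq_intros 1 2 refl | simp)+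
  also have "(1 / C) *\<^sub>R (cross3 B e3 - (kappa s * (B \<bullet> rhat s)) *\<^sub>R tau s) - F A B s *\<^sub>R nrm s
    = (- (B \<bullet> nrm s + kappa s * (B \<bullet> rhat s)) / C) *\<^sub>R tau s + ((B \<bullet> tau s) / C - F A B s) *\<^sub>R nrm s"
    unfolding cross3_e3_frame[OF assms] by (simp add: algebra_simps diff_divide_distrib)
  finally show ?thesis .
qed

lemma W_cont [continuous_intros]: "continuous_on I (W A B)"
  by (rule deriv_cont[OF W_deriv])

lemma W_3 [simp]:
  assumes "s \<in> I" shows "W A B s $ 3 = 0"
proof -
  have int: "(integral {0..s} g) $ 3 = integral {0..s} (\<lambda>t. g t $ 3)"
    if "continuous_on I g" for g :: "real \<Rightarrow> real ^ 3"
    using that assms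
    by (intro integral_component_eq_cart[symmetric] integrable_continuous_real)
      (auto elim: continuous_on_subset)
  show ?thesis
    unfolding W_def by (simp add: int continuous_intros cross3_simps)
qed

lemma r0_tau_deriv:
  "s \<in> I \<Longrightarrow> ((\<lambda>s. r0 s \<bullet> tau s) has_real_derivative 1 - kappa s * (r0 s \<bullet> nrm s)) (at s within I)"
  using has_real_derivative_inner[OF r0_deriv tau_deriv] by (simp add: frame_inner)

lemma rho_deriv: "s \<in> I \<Longrightarrow> ((\<lambda>s. cross3 (r0 s) e3) has_vector_derivative nrm s) (at s within I)"
  using has_vector_derivative_cross3_const[OF r0_deriv] by (simp add: nrm_eq)

lemma phi_deriv:
  "s \<in> I \<Longrightarrow> (phi has_real_derivative 2 * area / sbar - r0 s \<bullet> nrm s) (at s within I)"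
  unfolding phi_def[abs_def]
  by (rule derivative_eq_intros has_real_derivative_integral continuous_intros refl | simp)+

lemma G_cont [continuous_intros]: "continuous_on I (G A B)"
  unfolding G_def[abs_def] by (intro continuous_intros)

lemma psi_deriv:
  "s \<in> I \<Longrightarrow> (psi A B has_real_derivative
     K0 A B - (tau s \<bullet> G A B s + 2 / (C * (1 - nu)) * Q A B s)) (at s within I)"
  unfolding psi_def[abs_def]
  by (rule derivative_eq_intros has_real_derivative_integral continuous_intros refl | simp)+

text \<open>All terms of the derivative lie in the plane of the cross-section, so it is enough to compare the
  components along \<open>\<tau>\<close> and \<open>n\<close>. Along \<open>\<tau>\<close> the terms containing \<open>r \<bullet> \<tau>\<close> cancel; along \<open>n\<close> they combine
  with those containing \<open>r \<bullet> n\<close> to \<open>\<nu> A \<bullet> (r \<times> e\<^sub>3)\<close>.\<close>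

lemma planar_deriv:
  assumes s: "s \<in> I"
  shows "(planar A B K has_vector_derivative - hoop A B s *\<^sub>R tau s + twist A B K s *\<^sub>R nrm s)
    (at s within I)"
proof -
  note d = inner_const_deriv[OF rhat_deriv[OF s]] has_real_derivative_inner[OF r0_deriv[OF s] r0_deriv[OF s]]
    r0_deriv[OF s] rho_deriv[OF s] W_deriv[OF s]
  have 1: "A \<bullet> cross3 (r0 s) e3 = (r0 s \<bullet> tau s) * (A \<bullet> nrm s) - (r0 s \<bullet> nrm s) * (A \<bullet> tau s)"
    by (simp add: cross3_e3_frame[OF s] inner_add_right inner_diff_right)
  let ?W = "(- (B \<bullet> nrm s + kappa s * (B \<bullet> rhat s)) / C) *\<^sub>R tau s + ((B \<bullet> tau s) / C - F A B s) *\<^sub>R nrm s"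
  let ?d = "(nu * (r0 s \<bullet> tau s)) *\<^sub>R transv A - ((nu * (A \<bullet> rhat s)) *\<^sub>R tau s + (nu * (A \<bullet> tau s)) *\<^sub>R r0 s)
     - K *\<^sub>R nrm s + ?W"
  have "(planar A B K has_vector_derivative ?d) (at s within I)"
    unfolding planar_def[abs_def]
    by (rule derivative_eq_intros d refl | simp)+ (simp add: inner_commute mult.commute)
  also have "?d = - hoop A B s *\<^sub>R tau s + twist A B K s *\<^sub>R nrm s"
    by (rule frame_eqI[OF s])
      (simp_all add: inner_add_left inner_diff_left frame_inner[OF s] transv_inner hoop_def twist_def 1
        algebra_simps add_divide_distrib diff_divide_distrib)
  finally show ?thesis .
qed

text \<open>This relates \<open>H\<close> to the function \<open>G\<close> in the flexure function. The tangential components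
  differ by that of a rigid rotation with rate \<open>K\<close>, which the torsion function compensates up to the
  constant \<open>2 K area/sbar\<close>.\<close>

lemma tau_planar:
  assumes s: "s \<in> I"
  shows "tau s \<bullet> planar A B K s = tau s \<bullet> G A B s + K * (r0 s \<bullet> nrm s)"
proof -
  have 1: "(\<Sum>\<alpha>\<in>UNIV. x s $ \<alpha> * x s $ \<alpha>) = r0 s \<bullet> r0 s"
    by (simp add: r0_eq) (simp add: inner_vec_def)
  show ?thesis
    unfolding planar_def G_def 1 cross3_e3_frame[OF s]
    by (simp add: inner_add_right inner_diff_right frame_inner[OF s] transv_inner inner_commute[of "tau s" "transv A"]
        inner_commute[of "tau s" A] algebra_simps)
qed

lemma warp_deriv:
  assumes s: "s \<in> I"
  shows "(warp A B K has_real_derivative shear A B K s - tau s \<bullet> planar A B K s) (at s within I)"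
  unfolding warp_def[abs_def] tau_planar[OF s]
  by (rule derivative_eq_intros phi_deriv[OF s] psi_deriv[OF s] refl | simp)+
    (simp add: shear_def algebra_simps)

lemma shear_deriv:
  assumes s: "s \<in> I"
  shows "(shear A B K has_real_derivative - 2 / (C * (1 - nu)) * axial A B s) (at s within I)"
  unfolding shear_def[abs_def]
  by (rule derivative_eq_intros Q_deriv[OF s] refl | simp)+

definition twist_rate where
  "twist_rate A B s = nu * (A \<bullet> nrm s) - kappa s * (B \<bullet> nrm s) / C - bend A B s"

lemma twist_deriv:
  assumes s: "s \<in> I"
  shows "(twist A B K has_real_derivative twist_rate A B s) (at s within I)"
  unfolding twist_def[abs_def]
  by (rule derivative_eq_intros F_deriv[OF s] inner_const_deriv[OF rho_deriv[OF s]]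
      inner_const_deriv[OF tau_deriv[OF s]] refl | simp)+
    (simp add: twist_rate_def)

lemma u_hat_eq:
  "u_hat A B K s z = - (z ^ 3 / 6) *\<^sub>R transv A + (z\<^sup>2 / 2 * (A \<bullet> rhat s)) *\<^sub>R e3
     + z *\<^sub>R planar A B K s + warp A B K s *\<^sub>R e3"
proof -
  have 1: "(\<Sum>\<beta>\<in>UNIV. x s $ \<beta> * x s $ \<beta>) = r0 s \<bullet> r0 s"
    by (simp add: r0_eq) (simp add: inner_vec_def)
  have 2: "A \<bullet> ee \<alpha> = A $ 1" if "\<alpha> = 1" for \<alpha> using that by (simp add: inner_vec_def sum_3)
  have 3: "A \<bullet> ee 2 = A $ 2" by (simp add: inner_vec_def sum_3)
  show ?thesis
    unfolding u_hat_def planar_def warp_def 1 vec_eq_iff forall_3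
    by (simp add: sum_2 2 3 alt_def r0_eq cross3_def vector_def algebra_simps)
qed

section \<open>Derivatives of the displacement\<close>

lemma ds_eq:
  fixes f :: "real \<Rightarrow> real \<Rightarrow> 'a::euclidean_space"
  assumes "s \<in> I" "((\<lambda>\<sigma>. f \<sigma> z) has_vector_derivative f') (at s within I)"
  shows "ds f s z = f'"
  unfolding ds_def using D_on_eqI[OF sbar_pos assms] .

text \<open>Strains and stresses are computed on the shell only, so the closed form \<open>g\<close> is required to agree
  with \<open>f\<close> there; one-sided derivatives at the ends see nothing else.\<close>

lemma ds_rule:
  fixes f g :: "real \<Rightarrow> real \<Rightarrow> 'a::euclidean_space"
  assumes eq: "\<And>s z. s \<in> I \<Longrightarrow> z \<in> J \<Longrightarrow> f s z = g s z"
    and g: "\<And>s z. s \<in> I \<Longrightarrow> z \<in> J \<Longrightarrow> ((\<lambda>\<sigma>. g \<sigma> z) has_vector_derivative g' s z) (at s within I)"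
  shows "has_ds f" and "\<And>s z. s \<in> I \<Longrightarrow> z \<in> J \<Longrightarrow> ds f s z = g' s z"
proof -
  have f: "((\<lambda>\<sigma>. f \<sigma> z) has_vector_derivative g' s z) (at s within I)" if "s \<in> I" "z \<in> J" for s z
    using has_vector_derivative_transform[OF that(1) _ g[OF that], of "\<lambda>\<sigma>. f \<sigma> z"] eq that(2) by blast
  then show "has_ds f"
    unfolding has_ds_def differentiable_on_def by (blast intro: differentiableI_vector)
  show "ds f s z = g' s z" if "s \<in> I" "z \<in> J" for s z
    by (rule ds_eq[where f = f, OF that(1) f[OF that]])
qed

lemma dz_rule:
  fixes f g :: "real \<Rightarrow> real \<Rightarrow> 'a::euclidean_space"
  assumes eq: "\<And>s z. s \<in> I \<Longrightarrow> z \<in> J \<Longrightarrow> f s z = g s z"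
    and g: "\<And>s z. s \<in> I \<Longrightarrow> z \<in> J \<Longrightarrow> (g s has_vector_derivative g' s z) (at z within J)"
  shows "has_dz f" and "\<And>s z. s \<in> I \<Longrightarrow> z \<in> J \<Longrightarrow> dz f s z = g' s z"
proof -
  have f: "(f s has_vector_derivative g' s z) (at z within J)" if "s \<in> I" "z \<in> J" for s z
    using has_vector_derivative_transform[OF that(2) _ g[OF that], of "f s"] eq that(1) by blast
  then show "has_dz f"
    unfolding has_dz_def differentiable_on_def by (blast intro: differentiableI_vector)
  show "dz f s z = g' s z" if "s \<in> I" "z \<in> J" for s z
    unfolding dz_def using D_on_eqI[OF ell_pos that(2) f[OF that]] .
qed

lemmas real_ds_rule = ds_rule[where 'a = real, folded has_real_derivative_iff_has_vector_derivative]
lemmas real_dz_rule = dz_rule[where 'a = real, folded has_real_derivative_iff_has_vector_derivative]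

definition u_s where
  "u_s A B K s z = (z\<^sup>2 / 2 * (A \<bullet> tau s) + (shear A B K s - tau s \<bullet> planar A B K s)) *\<^sub>R e3
     + z *\<^sub>R (- hoop A B s *\<^sub>R tau s + twist A B K s *\<^sub>R nrm s)"

lemma u_hat_s:
  "has_ds (u_hat A B K)" "\<And>s z. s \<in> I \<Longrightarrow> z \<in> J \<Longrightarrow> ds (u_hat A B K) s z = u_s A B K s z"
proof -
  have *: "((\<lambda>\<sigma>. u_hat A B K \<sigma> z) has_vector_derivative u_s A B K s z) (at s within I)" if s: "s \<in> I" for s z
    unfolding u_hat_eq[abs_def] u_s_def
    by (rule derivative_eq_intros planar_deriv[OF s] warp_deriv[OF s] inner_const_deriv[OF rhat_deriv[OF s]] refl | simp)+
      (simp add: algebra_simps)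
  show "has_ds (u_hat A B K)" "\<And>s z. s \<in> I \<Longrightarrow> z \<in> J \<Longrightarrow> ds (u_hat A B K) s z = u_s A B K s z"
    by (rule ds_rule[where g = "u_hat A B K" and g' = "u_s A B K"]; (assumption | rule refl *)+)+
qed

abbreviation "u_z A B K s z \<equiv> - (z\<^sup>2 / 2) *\<^sub>R transv A + (z * (A \<bullet> rhat s)) *\<^sub>R e3 + planar A B K s"
abbreviation "u_sz A B K s z \<equiv> (z * (A \<bullet> tau s)) *\<^sub>R e3 + (- hoop A B s *\<^sub>R tau s + twist A B K s *\<^sub>R nrm s)"
abbreviation "u_zz A s z \<equiv> - z *\<^sub>R transv A + (A \<bullet> rhat s) *\<^sub>R e3"

lemma u_hat_z:
  "has_dz (u_hat A B K)" "\<And>s z. s \<in> I \<Longrightarrow> z \<in> J \<Longrightarrow> dz (u_hat A B K) s z = u_z A B K s z"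
proof -
  have *: "(u_hat A B K s has_vector_derivative u_z A B K s z) (at z within J)" for s z
    unfolding u_hat_eq[abs_def]
    by (rule derivative_eq_intros refl | simp)+
  show "has_dz (u_hat A B K)" "\<And>s z. s \<in> I \<Longrightarrow> z \<in> J \<Longrightarrow> dz (u_hat A B K) s z = u_z A B K s z"
    by (rule dz_rule[where g = "u_hat A B K" and g' = "u_z A B K"]; (assumption | rule refl *)+)+
qed

lemma u_hat_sz:
  "has_dz (ds (u_hat A B K))"
  "\<And>s z. s \<in> I \<Longrightarrow> z \<in> J \<Longrightarrow> dz (ds (u_hat A B K)) s z = u_sz A B K s z"
proof -
  have *: "(u_s A B K s has_vector_derivative u_sz A B K s z) (at z within J)" for s z
    unfolding u_s_def[abs_def]
    by (rule derivative_eq_intros refl | simp)+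
  show "has_dz (ds (u_hat A B K))"
    "\<And>s z. s \<in> I \<Longrightarrow> z \<in> J \<Longrightarrow> dz (ds (u_hat A B K)) s z = u_sz A B K s z"
    by (rule dz_rule[where g = "u_s A B K" and g' = "u_sz A B K"]; (assumption | rule u_hat_s *)+)+
qed

lemma u_hat_zz:
  "has_dz (dz (u_hat A B K))"
  "\<And>s z. s \<in> I \<Longrightarrow> z \<in> J \<Longrightarrow> dz (dz (u_hat A B K)) s z = u_zz A s z"
proof -
  have *: "(u_z A B K s has_vector_derivative u_zz A s z) (at z within J)" for s z
    by (rule derivative_eq_intros refl | simp)+
  show "has_dz (dz (u_hat A B K))"
    "\<And>s z. s \<in> I \<Longrightarrow> z \<in> J \<Longrightarrow> dz (dz (u_hat A B K)) s z = u_zz A s z"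
    by (rule dz_rule[where g = "u_z A B K" and g' = "u_zz A"]; (assumption | rule u_hat_z *)+)+
qed

lemma hoop_cont [continuous_intros]: "continuous_on I (hoop A B)"
  unfolding hoop_def[abs_def] by (auto intro!: continuous_intros)

lemma planar_3 [simp]: "s \<in> I \<Longrightarrow> planar A B K s $ 3 = 0"
  by (simp add: planar_def cross3_def vector_def)

lemma ss_comp_rule:
  assumes s: "s \<in> I" and z: "z \<in> J"
    and g: "((\<lambda>\<sigma>. u_s A B K \<sigma> z \<bullet> d) has_real_derivative g') (at s within I)"
  shows "has_ss_comp (u_hat A B K) d s z" "ss_comp (u_hat A B K) d s z = g'"
proof -
  have "((\<lambda>\<sigma>. ds (u_hat A B K) \<sigma> z \<bullet> d) has_vector_derivative g') (at s within I)"
    using has_vector_derivative_transform[OF s _ g[unfolded has_real_derivative_iff_has_vector_derivative]]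
      u_hat_s(2) z by simp
  then show "has_ss_comp (u_hat A B K) d s z" "ss_comp (u_hat A B K) d s z = g'"
    unfolding has_ss_comp_def ss_comp_def using D_on_eqI[OF sbar_pos s]
    by (blast intro: differentiableI_vector)+
qed

text \<open>With the direction \<open>n(s)\<close> kept fixed, \<open>hoop \<tau> \<bullet> n(s)\<close> is the product of a continuous function and
  a differentiable one that vanishes at \<open>s\<close>. In the result the terms of \<open>\<kappa> hoop\<close> cancel
  against those of the derivative of \<open>twist\<close> that contain the curvature; the summand \<open>1/(CR\<^sup>2)\<close> in
  the definition of the displacement takes part in this.\<close>

lemma u_hat_ss_nrm:
  assumes s: "s \<in> I" and z: "z \<in> J"
  shows "has_ss_comp (u_hat A B K) (nrm s) s z"
    "ss_comp (u_hat A B K) (nrm s) s z = z * (nu * (A \<bullet> nrm s) - (B \<bullet> rhat s) / D)"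
proof -
  have t: "((\<lambda>\<sigma>. hoop A B \<sigma> * (nrm s \<bullet> tau \<sigma>)) has_real_derivative - hoop A B s * kappa s) (at s within I)"
    using has_real_derivative_mult_vanishing[OF _ inner_const_deriv[OF tau_deriv[OF s]], of "hoop A B" "nrm s"]
      hoop_cont s frame_inner[OF s] by (simp add: continuous_on_eq_continuous_within)
  have n: "((\<lambda>\<sigma>. twist A B K \<sigma> * (nrm s \<bullet> nrm \<sigma>)) has_real_derivative twist_rate A B s) (at s within I)"
    by (rule derivative_eq_intros twist_deriv[OF s] inner_const_deriv[OF nrm_deriv[OF s]] refl | simp add: frame_inner[OF s])+
  have eq: "u_s A B K \<sigma> z \<bullet> nrm s = z * (twist A B K \<sigma> * (nrm s \<bullet> nrm \<sigma>) - hoop A B \<sigma> * (nrm s \<bullet> tau \<sigma>))" for \<sigma>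
    by (simp add: u_s_def inner_add_left inner_diff_left inner_commute algebra_simps)
  have "((\<lambda>\<sigma>. u_s A B K \<sigma> z \<bullet> nrm s) has_real_derivative z * (twist_rate A B s + hoop A B s * kappa s)) (at s within I)"
    unfolding eq by (rule derivative_eq_intros t n refl | simp)+
  also have "twist_rate A B s + hoop A B s * kappa s = nu * (A \<bullet> nrm s) - (B \<bullet> rhat s) / D"
    by (simp add: twist_rate_def hoop_def bend_def cmpl_def inner_add_left add_divide_distrib algebra_simps power2_eq_square)
  finally show "has_ss_comp (u_hat A B K) (nrm s) s z"
    "ss_comp (u_hat A B K) (nrm s) s z = z * (nu * (A \<bullet> nrm s) - (B \<bullet> rhat s) / D)"
    by (rule ss_comp_rule[OF s z])+
qed

lemma tau_planar_deriv:
  assumes s: "s \<in> I"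
  shows "((\<lambda>s. tau s \<bullet> planar A B K s) has_real_derivative - hoop A B s - kappa s * (nrm s \<bullet> planar A B K s)) (at s within I)"
  using has_real_derivative_inner[OF tau_deriv[OF s] planar_deriv[OF s]]
  by (simp add: inner_add_right frame_inner[OF s] inner_diff_right)

lemma u_hat_ss_e3:
  assumes s: "s \<in> I" and z: "z \<in> J"
  shows "has_ss_comp (u_hat A B K) e3 s z"
    "ss_comp (u_hat A B K) e3 s z = - z\<^sup>2 / 2 * kappa s * (A \<bullet> nrm s)
      - 2 / (C * (1 - nu)) * axial A B s + hoop A B s + kappa s * (nrm s \<bullet> planar A B K s)"
proof -
  have eq: "u_s A B K \<sigma> z \<bullet> e3 = z\<^sup>2 / 2 * (A \<bullet> tau \<sigma>) + (shear A B K \<sigma> - tau \<sigma> \<bullet> planar A B K \<sigma>)" for \<sigma>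
    by (simp add: u_s_def)
  have "((\<lambda>\<sigma>. u_s A B K \<sigma> z \<bullet> e3) has_real_derivative - z\<^sup>2 / 2 * kappa s * (A \<bullet> nrm s)
      - 2 / (C * (1 - nu)) * axial A B s + hoop A B s + kappa s * (nrm s \<bullet> planar A B K s)) (at s within I)"
    unfolding eq
    by (rule derivative_eq_intros inner_const_deriv[OF tau_deriv[OF s]] shear_deriv[OF s] tau_planar_deriv[OF s] refl | simp)+
  then show "has_ss_comp (u_hat A B K) e3 s z"
    "ss_comp (u_hat A B K) e3 s z = - z\<^sup>2 / 2 * kappa s * (A \<bullet> nrm s)
      - 2 / (C * (1 - nu)) * axial A B s + hoop A B s + kappa s * (nrm s \<bullet> planar A B K s)"
    by (rule ss_comp_rule[OF s z])+
qed

section \<open>Stresses and equilibrium\<close>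

text \<open>The membrane part \<open>N_ss = - z (B \<bullet> n + \<kappa> b)\<close> and the bending part \<open>- \<kappa> M_ss = z \<kappa> b\<close> add up so that
  the curvature drops out of \<open>P_ss\<close>, which makes \<open>P_ss\<close> differentiable on a \<open>C\<^sup>2\<close> curve.\<close>

lemma stresses:
  assumes s: "s \<in> I" and z: "z \<in> J"
  shows "M_ss (u_hat A B K) s z = - z * (B \<bullet> rhat s)"
    "M_sz (u_hat A B K) s z = D * (1 - nu) * twist A B K s"
    "M_zz (u_hat A B K) s z = - z * couple A B s"
    "P_ss (u_hat A B K) s z = - z * (B \<bullet> nrm s)"
    "P_zs (u_hat A B K) s z = C * (1 - nu) / 2 * shear A B K s"
    "P_sz (u_hat A B K) s z = C * (1 - nu) / 2 * shear A B K s - kappa s * (D * (1 - nu) * twist A B K s)"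
    "P_zz (u_hat A B K) s z = z * axial A B s"
proof -
  note fi = frame_inner[OF s] inner_add_left inner_diff_left
  have e: "eps_ss (u_hat A B K) s z = - z * hoop A B s"
    "eps_zz (u_hat A B K) s z = z * (A \<bullet> rhat s)"
    "eps_sz (u_hat A B K) s z = shear A B K s / 2"
    using s by (simp_all add: eps_ss_def eps_zz_def eps_sz_def u_hat_s(2)[OF s z] u_hat_z(2)[OF s z] u_s_def fi
      transv_inner inner_commute[of "planar A B K s"] del: atLeastAtMost_iff)
  have r: "rho_ss (u_hat A B K) s z = z * (nu * (A \<bullet> nrm s) - (B \<bullet> rhat s) / D)"
    "rho_sz (u_hat A B K) s z = twist A B K s"
    "rho_zz (u_hat A B K) s z = - z * (A \<bullet> nrm s)"
    by (simp_all add: rho_ss_def rho_sz_def rho_zz_def u_hat_ss_nrm(2)[OF s z] u_hat_sz(2)[OF s z] u_hat_zz(2)[OF s z] fi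
      transv_inner)
  show m: "M_ss (u_hat A B K) s z = - z * (B \<bullet> rhat s)"
    "M_sz (u_hat A B K) s z = D * (1 - nu) * twist A B K s"
    "M_zz (u_hat A B K) s z = - z * couple A B s"
    by (simp_all add: M_ss_def M_sz_def M_zz_def r couple_def algebra_simps power2_eq_square)
  have n: "N_ss (u_hat A B K) s z = - z * (B \<bullet> nrm s + kappa s * (B \<bullet> rhat s))"
    "N_sz (u_hat A B K) s z = C * (1 - nu) / 2 * shear A B K s"
    "N_zz (u_hat A B K) s z = z * axial A B s"
    by (simp_all add: N_ss_def N_sz_def N_zz_def e hoop_def axial_def field_simps power2_eq_square inner_add_right)
  show "P_ss (u_hat A B K) s z = - z * (B \<bullet> nrm s)"
    "P_zs (u_hat A B K) s z = C * (1 - nu) / 2 * shear A B K s"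
    "P_sz (u_hat A B K) s z = C * (1 - nu) / 2 * shear A B K s - kappa s * (D * (1 - nu) * twist A B K s)"
    "P_zz (u_hat A B K) s z = z * axial A B s"
    by (simp_all add: P_ss_def P_zs_def P_sz_def P_zz_def n m algebra_simps)
qed

lemma stress_rates_s:
  "has_ds (M_ss (u_hat A B K))"
  "\<And>s z. s \<in> I \<Longrightarrow> z \<in> J \<Longrightarrow> ds (M_ss (u_hat A B K)) s z = - z * (B \<bullet> tau s)"
  "has_ds (M_sz (u_hat A B K))"
  "\<And>s z. s \<in> I \<Longrightarrow> z \<in> J \<Longrightarrow> ds (M_sz (u_hat A B K)) s z = D * (1 - nu) * twist_rate A B s"
  "has_ds (P_ss (u_hat A B K))"
  "\<And>s z. s \<in> I \<Longrightarrow> z \<in> J \<Longrightarrow> ds (P_ss (u_hat A B K)) s z = - z * kappa s * (B \<bullet> tau s)"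
  "has_ds (P_zs (u_hat A B K))"
  "\<And>s z. s \<in> I \<Longrightarrow> z \<in> J \<Longrightarrow> ds (P_zs (u_hat A B K)) s z = - axial A B s"
proof -
  have 1: "((\<lambda>s. - z * (B \<bullet> rhat s)) has_real_derivative - z * (B \<bullet> tau s)) (at s within I)"
    if s: "s \<in> I" for s z
    by (rule derivative_eq_intros inner_const_deriv[OF rhat_deriv[OF s]] refl | simp)+
  have 2: "((\<lambda>s. D * (1 - nu) * twist A B K s) has_real_derivative D * (1 - nu) * twist_rate A B s) (at s within I)"
    if s: "s \<in> I" for s
    by (rule derivative_eq_intros twist_deriv[OF s] refl | simp)+
  have 3: "((\<lambda>s. - z * (B \<bullet> nrm s)) has_real_derivative - z * kappa s * (B \<bullet> tau s)) (at s within I)"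
    if s: "s \<in> I" for s z
    by (rule derivative_eq_intros inner_const_deriv[OF nrm_deriv[OF s]] refl | simp)+
  have 4: "((\<lambda>s. C * (1 - nu) / 2 * shear A B K s) has_real_derivative - axial A B s) (at s within I)"
    if s: "s \<in> I" for s
    using nu_bounds by (auto intro!: derivative_eq_intros shear_deriv[OF s])
  show "has_ds (M_ss (u_hat A B K))"
    "\<And>s z. s \<in> I \<Longrightarrow> z \<in> J \<Longrightarrow> ds (M_ss (u_hat A B K)) s z = - z * (B \<bullet> tau s)"
    by (rule real_ds_rule[where g = "\<lambda>s z. - z * (B \<bullet> rhat s)" and g' = "\<lambda>s z. - z * (B \<bullet> tau s)"];
        (assumption | rule stresses 1)+)+
  show "has_ds (M_sz (u_hat A B K))"
    "\<And>s z. s \<in> I \<Longrightarrow> z \<in> J \<Longrightarrow> ds (M_sz (u_hat A B K)) s z = D * (1 - nu) * twist_rate A B s"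
    by (rule real_ds_rule[where g = "\<lambda>s z. D * (1 - nu) * twist A B K s" and g' = "\<lambda>s z. D * (1 - nu) * twist_rate A B s"];
        (assumption | rule stresses 2)+)+
  show "has_ds (P_ss (u_hat A B K))"
    "\<And>s z. s \<in> I \<Longrightarrow> z \<in> J \<Longrightarrow> ds (P_ss (u_hat A B K)) s z = - z * kappa s * (B \<bullet> tau s)"
    by (rule real_ds_rule[where g = "\<lambda>s z. - z * (B \<bullet> nrm s)" and g' = "\<lambda>s z. - z * kappa s * (B \<bullet> tau s)"];
        (assumption | rule stresses 3)+)+
  show "has_ds (P_zs (u_hat A B K))"
    "\<And>s z. s \<in> I \<Longrightarrow> z \<in> J \<Longrightarrow> ds (P_zs (u_hat A B K)) s z = - axial A B s"
    by (rule real_ds_rule[where g = "\<lambda>s z. C * (1 - nu) / 2 * shear A B K s" and g' = "\<lambda>s z. - axial A B s"];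
        (assumption | rule stresses 4)+)+
qed

lemma stress_rates_z:
  "has_dz (M_zs (u_hat A B K))"
  "\<And>s z. s \<in> I \<Longrightarrow> z \<in> J \<Longrightarrow> dz (M_zs (u_hat A B K)) s z = 0"
  "has_dz (M_zz (u_hat A B K))"
  "\<And>s z. s \<in> I \<Longrightarrow> z \<in> J \<Longrightarrow> dz (M_zz (u_hat A B K)) s z = - couple A B s"
  "has_dz (P_sz (u_hat A B K))"
  "\<And>s z. s \<in> I \<Longrightarrow> z \<in> J \<Longrightarrow> dz (P_sz (u_hat A B K)) s z = 0"
  "has_dz (P_zz (u_hat A B K))"
  "\<And>s z. s \<in> I \<Longrightarrow> z \<in> J \<Longrightarrow> dz (P_zz (u_hat A B K)) s z = axial A B s"
proof -
  have 1: "((\<lambda>z. - z * couple A B s) has_real_derivative - couple A B s) (at z within J)" for s z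
    by (rule derivative_eq_intros refl | simp)+
  have 2: "((\<lambda>z. z * axial A B s) has_real_derivative axial A B s) (at z within J)" for s z
    by (rule derivative_eq_intros refl | simp)+
  show "has_dz (M_zs (u_hat A B K))"
    "\<And>s z. s \<in> I \<Longrightarrow> z \<in> J \<Longrightarrow> dz (M_zs (u_hat A B K)) s z = 0"
    by (rule real_dz_rule[where g = "\<lambda>s z. D * (1 - nu) * twist A B K s" and g' = "\<lambda>s z. 0"];
        (assumption | rule stresses DERIV_const)+)+
  show "has_dz (M_zz (u_hat A B K))"
    "\<And>s z. s \<in> I \<Longrightarrow> z \<in> J \<Longrightarrow> dz (M_zz (u_hat A B K)) s z = - couple A B s"
    by (rule real_dz_rule[where g = "\<lambda>s z. - z * couple A B s" and g' = "\<lambda>s z. - couple A B s"];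
        (assumption | rule stresses 1)+)+
  show "has_dz (P_sz (u_hat A B K))"
    "\<And>s z. s \<in> I \<Longrightarrow> z \<in> J \<Longrightarrow> dz (P_sz (u_hat A B K)) s z = 0"
    by (rule real_dz_rule[where g = "\<lambda>s z. C * (1 - nu) / 2 * shear A B K s - kappa s * (D * (1 - nu) * twist A B K s)"
          and g' = "\<lambda>s z. 0"];
        (assumption | rule stresses DERIV_const)+)+
  show "has_dz (P_zz (u_hat A B K))"
    "\<And>s z. s \<in> I \<Longrightarrow> z \<in> J \<Longrightarrow> dz (P_zz (u_hat A B K)) s z = axial A B s"
    by (rule real_dz_rule[where g = "\<lambda>s z. z * axial A B s" and g' = "\<lambda>s z. axial A B s"];
        (assumption | rule stresses 2)+)+
qed

lemma transverse_shear:
  assumes s: "s \<in> I" and z: "z \<in> J"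
  shows "S_s (u_hat A B K) s z = z * (B \<bullet> tau s)"
    "S_z (u_hat A B K) s z = couple A B s - D * (1 - nu) * twist_rate A B s"
  using s z by (simp_all add: S_s_def S_z_def stress_rates_s stress_rates_z del: atLeastAtMost_iff)

lemma transverse_shear_rates:
  "has_ds (S_s (u_hat A B K))"
  "\<And>s z. s \<in> I \<Longrightarrow> z \<in> J \<Longrightarrow> ds (S_s (u_hat A B K)) s z = - z * kappa s * (B \<bullet> nrm s)"
  "has_dz (S_z (u_hat A B K))"
  "\<And>s z. s \<in> I \<Longrightarrow> z \<in> J \<Longrightarrow> dz (S_z (u_hat A B K)) s z = 0"
proof -
  have 1: "((\<lambda>s. z * (B \<bullet> tau s)) has_real_derivative - z * kappa s * (B \<bullet> nrm s)) (at s within I)"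
    if s: "s \<in> I" for s z
    by (rule derivative_eq_intros inner_const_deriv[OF tau_deriv[OF s]] refl | simp)+
  show "has_ds (S_s (u_hat A B K))"
    "\<And>s z. s \<in> I \<Longrightarrow> z \<in> J \<Longrightarrow> ds (S_s (u_hat A B K)) s z = - z * kappa s * (B \<bullet> nrm s)"
    by (rule real_ds_rule[where g = "\<lambda>s z. z * (B \<bullet> tau s)" and g' = "\<lambda>s z. - z * kappa s * (B \<bullet> nrm s)"];
        (assumption | rule transverse_shear 1)+)+
  show "has_dz (S_z (u_hat A B K))"
    "\<And>s z. s \<in> I \<Longrightarrow> z \<in> J \<Longrightarrow> dz (S_z (u_hat A B K)) s z = 0"
    by (rule real_dz_rule[where g = "\<lambda>s z. couple A B s - D * (1 - nu) * twist_rate A B s" and g' = "\<lambda>s z. 0"];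
        (assumption | rule transverse_shear DERIV_const)+)+
qed

lemma u_hat_regular: "regular (u_hat A B K)"
  unfolding regular_def
  using u_hat_s(1) u_hat_z(1) u_hat_sz(1) u_hat_zz(1) u_hat_ss_nrm(1)
    stress_rates_s(1,3,5,7) stress_rates_z(1,3,5,7) transverse_shear_rates(1,3)
  by (simp del: atLeastAtMost_iff)

text \<open>The first and third equations hold because \<open>- B \<bullet> n\<close> and \<open>B \<bullet> \<tau>\<close>, being the components of a
  constant vector in the moving frame, have derivatives \<open>- \<kappa> B \<bullet> \<tau>\<close> and \<open>- \<kappa> B \<bullet> n\<close>; the second one
  because \<open>P_zs\<close> contains \<open>- Q\<close>, whose derivative balances \<open>P\<^bsub>zz,z\<^esub>\<close>.\<close>

lemma u_hat_equilibrium: "equilibrium (u_hat A B K)"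
  unfolding equilibrium_def
  by (simp add: stress_rates_s stress_rates_z transverse_shear_rates transverse_shear stresses(4))

section \<open>Continuity across the seam\<close>

text \<open>Integration by parts, written as a derivative: adding \<open>(b/C) n + F (r \<times> e\<^sub>3)\<close> to \<open>W\<close> turns
  its derivative into the integrand of \<open>seam_gap\<close>, rotated by a right angle in the plane of the
  cross-section. Once \<open>F\<close> closes up, the added terms do too, and the increment of \<open>W\<close> is the rotated
  \<open>seam_gap\<close>.\<close>

lemma seam_gap_closed:
  assumes "seam_gap A B = 0"
  shows "F A B sbar = F A B 0" "W A B sbar = W A B 0"
proof -
  show F: "F A B sbar = F A B 0"
    using seam_gap_3[of A B] assms sbar_pos by (simp add: F_eq)
  let ?l = "\<lambda>s. bend A B s *\<^sub>R rhat s + (1 / C) *\<^sub>R (transv B + (B \<bullet> tau s) *\<^sub>R tau s)"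
  let ?g = "\<lambda>s. W A B s + ((B \<bullet> rhat s) / C) *\<^sub>R nrm s + F A B s *\<^sub>R cross3 (r0 s) e3"
  \<comment> \<open>The cross product with \<open>e\<^sub>3\<close> removes the axial part, so that \<open>rhat\<close> goes to \<open>r \<times> e\<^sub>3\<close>, and
    rotates \<open>\<tau>\<close> to \<open>n\<close>.\<close>
  have "(?g has_vector_derivative cross3 (?l s) e3) (at s within I)" if s: "s \<in> I" for s
  proof -
    have "(?g has_vector_derivative
      ((- (B \<bullet> nrm s + kappa s * (B \<bullet> rhat s)) / C) *\<^sub>R tau s + ((B \<bullet> tau s) / C - F A B s) *\<^sub>R nrm s)
      + (((B \<bullet> rhat s) / C) *\<^sub>R (kappa s *\<^sub>R tau s) + ((B \<bullet> tau s) / C) *\<^sub>R nrm s)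
      + (F A B s *\<^sub>R nrm s + bend A B s *\<^sub>R cross3 (r0 s) e3)) (at s within I)"
      by (rule derivative_eq_intros W_deriv[OF s] inner_const_deriv[OF rhat_deriv[OF s]] nrm_deriv[OF s]
          F_deriv[OF s] rho_deriv[OF s] refl | simp)+
    also have "((- (B \<bullet> nrm s + kappa s * (B \<bullet> rhat s)) / C) *\<^sub>R tau s + ((B \<bullet> tau s) / C - F A B s) *\<^sub>R nrm s)
      + (((B \<bullet> rhat s) / C) *\<^sub>R (kappa s *\<^sub>R tau s) + ((B \<bullet> tau s) / C) *\<^sub>R nrm s)
      + (F A B s *\<^sub>R nrm s + bend A B s *\<^sub>R cross3 (r0 s) e3)
      = bend A B s *\<^sub>R cross3 (r0 s) e3 + (1 / C) *\<^sub>R ((- (B \<bullet> nrm s)) *\<^sub>R tau s + (B \<bullet> tau s) *\<^sub>R nrm s + (B \<bullet> tau s) *\<^sub>R nrm s)"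
      by (simp add: algebra_simps diff_divide_distrib)
    also have "\<dots> = cross3 (?l s) e3"
    proof -
      have "cross3 (rhat s) e3 = cross3 (r0 s) e3" "cross3 (transv B) e3 = cross3 B e3"
        by (simp_all add: vec_eq_iff forall_3 cross3_def vector_def rhat_eq r0_eq)
      then show ?thesis
        by (simp add: cross_add_left cross_mult_left nrm_eq[symmetric] cross3_e3_frame[OF s, of B])
    qed
    finally show ?thesis .
  qed
  then have "((\<lambda>s. cross3 (?l s) e3) has_integral ?g sbar - ?g 0) I"
    using sbar_pos by (intro fundamental_theorem_of_calculus) auto
  moreover have "((\<lambda>s. cross3 (?l s) e3) has_integral cross3 (seam_gap A B) e3) I"
  proof -
    have "(?l has_integral seam_gap A B) I"
      unfolding seam_gap_def by (intro integrable_integral integrable_continuous_real continuous_intros)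
    then show ?thesis
      using has_integral_linear[OF _ bounded_linear_cross3_left[of e3]] by (simp only: o_def)
  qed
  ultimately have "?g sbar - ?g 0 = cross3 (seam_gap A B) e3"
    by (rule has_integral_unique)
  then show "W A B sbar = W A B 0"
    using assms F by (simp add: geometry_closed)
qed

lemma edge_load_closed:
  assumes "edge_load A B = - lift R0"
  shows "Q A B sbar = Q A B 0"
  using edge_load_3[of A B] assms sbar_pos by (simp add: Q_eq)

text \<open>The linear terms in \<open>phi\<close> and \<open>psi\<close> are those which make both vanish at \<open>s = sbar\<close>.\<close>

lemma warp_closed: "warp A B K sbar = warp A B K 0"
  unfolding warp_def phi_def psi_def using sbar_pos by (simp add: area_def K0_def)

lemma fields_closed:
  assumes "seam_gap A B = 0" "edge_load A B = - lift R0"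
  shows "planar A B K sbar = planar A B K 0" "hoop A B sbar = hoop A B 0" "twist A B K sbar = twist A B K 0"
    "shear A B K sbar = shear A B K 0" "axial A B sbar = axial A B 0" "twist_rate A B sbar = twist_rate A B 0"
  by (simp_all add: planar_def hoop_def twist_def shear_def axial_def twist_rate_def bend_def geometry_closed
      seam_gap_closed[OF assms(1)] edge_load_closed[OF assms(2)])

lemma u_hat_seam:
  assumes "seam_gap A B = 0" "edge_load A B = - lift R0"
  shows "seam_continuity (u_hat A B K)"
proof -
  note c = fields_closed[OF assms] warp_closed geometry_closed
  have 0: "0 \<in> I" "sbar \<in> I" using sbar_pos by simp_all
  show ?thesis
    unfolding seam_continuity_def
    using u_hat_ss_nrm(1)[OF 0(1)] u_hat_ss_nrm(1)[OF 0(2)] u_hat_ss_e3(1)[OF 0(1)] u_hat_ss_e3(1)[OF 0(2)]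
    by (auto simp del: atLeastAtMost_iff
      simp: u_hat_s(2)[OF 0(1)] u_hat_s(2)[OF 0(2)] u_hat_ss_nrm(2)[OF 0(1)] u_hat_ss_nrm(2)[OF 0(2), unfolded geometry_closed]
        u_hat_ss_e3(2)[OF 0(1)] u_hat_ss_e3(2)[OF 0(2)] u_hat_eq u_s_def c)
qed

text \<open>With a third derivative of the curve, \<open>\<kappa>\<close> and therefore \<open>hoop\<close> are differentiable, and
  \<open>u\<^bsub>,ss\<^esub>\<close> is an expression in functions that all return to their initial values.\<close>

lemma u_hat_seam_ss:
  assumes "seam_gap A B = 0" "edge_load A B = - lift R0" "third_derivative_closed x sbar"
  shows "seam_continuity_ss (u_hat A B K)"
proof -
  define d3 where "d3 = D_on sbar ddx"
  have d3: "(ddx has_vector_derivative d3 s) (at s within I)" if "s \<in> I" for s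
    using D_on_works[of ddx sbar s] that assms(3)
    unfolding third_derivative_closed_def d3_def ddx_def dx_def by blast
  have d3_closed: "d3 sbar = d3 0"
    using assms(3) unfolding third_derivative_closed_def d3_def ddx_def dx_def by simp
  define k' where "k' s = dx s $ 1 * d3 s $ 2 - dx s $ 2 * d3 s $ 1" for s
  have comp: "((\<lambda>s. g s $ i) has_real_derivative g' $ i) (at s within I)"
    if "(g has_vector_derivative g') (at s within I)" for g :: "real \<Rightarrow> real^2" and g' i s
    using bounded_linear.has_vector_derivative[OF bounded_linear_vec_nth that]
    by (simp add: has_real_derivative_iff_has_vector_derivative)
  have kd: "(kappa has_real_derivative k' s) (at s within I)" if s: "s \<in> I" for s
    unfolding kappa_eq[abs_def]
    by (rule derivative_eq_intros comp[OF dx_deriv[OF s]] comp[OF d3[OF s]] refl | simp add: k'_def)+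
  define h' where "h' s = nu * (A \<bullet> tau s) + (2 * kappa s * (B \<bullet> tau s) + k' s * (B \<bullet> rhat s)) / C" for s
  have hd: "(hoop A B has_real_derivative h' s) (at s within I)" if s: "s \<in> I" for s
    unfolding hoop_def[abs_def]
    by (rule derivative_eq_intros kd[OF s] inner_const_deriv[OF rhat_deriv[OF s]] inner_const_deriv[OF nrm_deriv[OF s]] refl | simp)+
      (simp add: h'_def)
  let ?u = "\<lambda>s z. (- z\<^sup>2 / 2 * kappa s * (A \<bullet> nrm s)
      - 2 / (C * (1 - nu)) * axial A B s + hoop A B s + kappa s * (nrm s \<bullet> planar A B K s)) *\<^sub>R e3
      + z *\<^sub>R (- (hoop A B s *\<^sub>R (- kappa s *\<^sub>R nrm s) + h' s *\<^sub>R tau s) + (twist A B K s *\<^sub>R (kappa s *\<^sub>R tau s) + twist_rate A B s *\<^sub>R nrm s))"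
  have *: "((\<lambda>\<sigma>. u_s A B K \<sigma> z) has_vector_derivative ?u s z) (at s within I)" if s: "s \<in> I" for s z
    unfolding u_s_def scaleR_minus_left
    by (rule derivative_eq_intros hd[OF s] twist_deriv[OF s] tau_deriv[OF s] nrm_deriv[OF s] shear_deriv[OF s]
        tau_planar_deriv[OF s] inner_const_deriv[OF tau_deriv[OF s]] refl | simp)+
  have ss: "has_ds (ds (u_hat A B K))" "\<And>s z. s \<in> I \<Longrightarrow> z \<in> J \<Longrightarrow> ds (ds (u_hat A B K)) s z = ?u s z"
    by (rule ds_rule[where g = "u_s A B K" and g' = ?u]; (assumption | rule u_hat_s *)+)+
  have "?u 0 z = ?u sbar z" for z
    by (simp add: fields_closed[OF assms(1,2)] geometry_closed h'_def k'_def d3_closed dx_closed)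
  then show ?thesis
    unfolding seam_continuity_ss_def using ss sbar_pos by simp
qed

section \<open>Resultants on the end edge\<close>

lemma zero_in_J: "0 \<in> J" using ell_pos by simp

text \<open>The terms \<open>P_sz \<tau>\<close> and \<open>S_z n\<close> contain the derivative of the periodic function \<open>- M_sz n\<close>, and the
  integral of \<open>N_sz \<tau>\<close> is found from \<open>(N_sz r)' = N_sz \<tau> - axial r\<close>. What remains is the integrand of
  \<open>edge_load\<close>, whose additional axial part \<open>sbar axial\<close> is the derivative of \<open>sbar Q\<close>.\<close>

lemma edge_force_integral:
  assumes "seam_gap A B = 0" "edge_load A B = - lift R0"
  shows "(edge_force (u_hat A B K) has_integral - lift R0) I"
proof -
  let ?T = "\<lambda>s. C * (1 - nu) / 2 * shear A B K s" and ?M = "D * (1 - nu)"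
  let ?g = "\<lambda>s. ?T s *\<^sub>R r0 s - (?M * twist A B K s) *\<^sub>R nrm s - (sbar * Q A B s) *\<^sub>R e3"
  let ?g' = "\<lambda>s. (?T s *\<^sub>R tau s - axial A B s *\<^sub>R r0 s)
     - ((?M * twist A B K s) *\<^sub>R (kappa s *\<^sub>R tau s) + (?M * twist_rate A B s) *\<^sub>R nrm s) - (sbar * axial A B s) *\<^sub>R e3"
  let ?l = "\<lambda>s. axial A B s *\<^sub>R rhat s + couple A B s *\<^sub>R nrm s"
  have "(?g has_vector_derivative ?g' s) (at s within I)" if s: "s \<in> I" for s
    by (rule derivative_eq_intros shear_deriv[OF s] twist_deriv[OF s] Q_deriv[OF s] r0_deriv[OF s]
        nrm_deriv[OF s] refl | simp)+
      (simp add: mult.commute)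
  then have "(?g' has_integral 0) I"
    by (rule integral_of_periodic_derivative[where g = ?g])
      (simp_all add: fields_closed[OF assms] geometry_closed edge_load_closed[OF assms(2)])
  moreover have "(?l has_integral edge_load A B) I"
    unfolding edge_load_def by (intro integrable_integral integrable_continuous_real continuous_intros)
  ultimately have total: "((\<lambda>s. ?g' s + ?l s) has_integral 0 + edge_load A B) I"
    by (rule has_integral_add)
  have eq: "?g' s + ?l s = edge_force (u_hat A B K) s" if "s \<in> I" for s
    unfolding edge_force_def stresses[OF that zero_in_J] transverse_shear[OF that zero_in_J]
    by (simp add: rhat_eq r0_eq algebra_simps)
  show ?thesis
    using has_integral_eq[OF eq total] assms(2) by simp
qed

text \<open>At \<open>z = 0\<close> the stresses \<open>P_zz\<close> and \<open>M_zz\<close> vanish and the edge moment is axial. Because of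
  \<open>(r \<bullet> \<tau>)' = 1 - \<kappa> (r \<bullet> n)\<close>, the terms with \<open>M_sz\<close> are the derivative of \<open>M_sz (r \<bullet> \<tau>)\<close> minus
  \<open>2 M_sz\<close>. Collecting the coefficient of \<open>K\<close> in the rest, through \<open>shear\<close> and \<open>twist\<close>, gives
  the equation for the torsion constant.\<close>

lemma edge_moment_integral:
  assumes "seam_gap A B = 0" "edge_load A B = - lift R0" "K_equation A B K"
  shows "(edge_moment (u_hat A B K) has_integral 0) I"
proof -
  \<comment> \<open>The part of \<open>N_sz\<close> that does not depend on \<open>s\<close>; the other part is \<open>- Q\<close>.\<close>
  let ?T0 = "C * (1 - nu) / 2 * (2 * K * area / sbar + K0 A B)" and ?M = "D * (1 - nu)"
  let ?h' = "\<lambda>s. ?M * (twist_rate A B s * (r0 s \<bullet> tau s) + twist A B K s * (1 - kappa s * (r0 s \<bullet> nrm s)))"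
  let ?i1 = "\<lambda>s. nu * (A \<bullet> cross3 (r0 s) e3) - F A B s"
  let ?i2 = "\<lambda>s. (r0 s \<bullet> tau s) * (D * (1 - nu\<^sup>2) * (A \<bullet> nrm s) + nu * (B \<bullet> rhat s)) + (r0 s \<bullet> nrm s) * Q A B s"
  have h: "(?h' has_integral 0) I"
  proof (rule integral_of_periodic_derivative[where g = "\<lambda>s. ?M * (twist A B K s * (r0 s \<bullet> tau s))"])
    fix s assume s: "s \<in> I"
    have "((\<lambda>s. ?M * (twist A B K s * (r0 s \<bullet> tau s))) has_real_derivative ?h' s) (at s within I)"
      by (rule derivative_eq_intros twist_deriv[OF s] r0_tau_deriv[OF s] refl | simp)+
    then show "((\<lambda>s. ?M * (twist A B K s * (r0 s \<bullet> tau s))) has_vector_derivative ?h' s) (at s within I)"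
      by (simp add: has_real_derivative_iff_has_vector_derivative)
  qed (simp add: fields_closed[OF assms(1,2)] geometry_closed)
  have t: "((\<lambda>s. B \<bullet> tau s) has_integral 0) I"
  proof (rule integral_of_periodic_derivative[where g = "\<lambda>s. B \<bullet> r0 s"])
    show "((\<lambda>s. B \<bullet> r0 s) has_vector_derivative B \<bullet> tau s) (at s within I)" if "s \<in> I" for s
      using inner_const_deriv[OF r0_deriv[OF that]] by (simp add: has_real_derivative_iff_has_vector_derivative)
  qed (simp add: geometry_closed)
  have a: "((\<lambda>s. r0 s \<bullet> nrm s) has_integral 2 * area) I"
    unfolding area_def by (auto intro!: integrable_integral integrable_continuous_real continuous_intros)
  have rho: "continuous_on I (\<lambda>s. cross3 (r0 s) e3)"
    by (rule deriv_cont[OF rho_deriv])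
  have i1: "(?i1 has_integral integral I ?i1) I" and i2: "(?i2 has_integral integral I ?i2) I"
    by (intro integrable_integral integrable_continuous_real continuous_intros rho)+
  have K: "((\<lambda>s. K) has_integral K * sbar) I"
    using has_integral_const_real[of K 0 sbar] sbar_pos by (simp add: mult.commute)
  have "((\<lambda>s. ?T0 * (r0 s \<bullet> nrm s) - ?i2 s - 2 * ?M * ?i1 s + 2 * ?M * K - 2 * ?M / C * (B \<bullet> tau s) + ?h' s)
    has_integral ?T0 * (2 * area) - integral I ?i2 - 2 * ?M * integral I ?i1 + 2 * ?M * (K * sbar) - 2 * ?M / C * 0 + 0) I"
    by (intro has_integral_add has_integral_diff has_integral_mult_right h t a i1 i2 K)
  also have "?T0 * (2 * area) - integral I ?i2 - 2 * ?M * integral I ?i1 + 2 * ?M * (K * sbar) - 2 * ?M / C * 0 + 0 = 0"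
  proof -
    have "K * (2 * (1 - nu) * (C * area\<^sup>2 / sbar + D * sbar))
        = ?T0 * (2 * area) - C * (1 - nu) * area * K0 A B + 2 * ?M * (K * sbar)"
      using sbar_pos by (simp add: field_simps power2_eq_square)
    moreover have "K * (2 * (1 - nu) * (C * area\<^sup>2 / sbar + D * sbar))
        = - C * (1 - nu) * area * K0 A B + 2 * ?M * integral I ?i1 + integral I ?i2"
      using assms(3) unfolding K_equation_def by (simp only: mult.assoc)
    ultimately show ?thesis
      by linarith
  qed
  finally have total: "((\<lambda>s. (?T0 * (r0 s \<bullet> nrm s) - ?i2 s - 2 * ?M * ?i1 s + 2 * ?M * K - 2 * ?M / C * (B \<bullet> tau s) + ?h' s) *\<^sub>R e3)
    has_integral 0 *\<^sub>R e3) I"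
    by (rule has_integral_scaleR_left)
  have eq: "(?T0 * (r0 s \<bullet> nrm s) - ?i2 s - 2 * ?M * ?i1 s + 2 * ?M * K - 2 * ?M / C * (B \<bullet> tau s) + ?h' s) *\<^sub>R e3
    = edge_moment (u_hat A B K) s" if s: "s \<in> I" for s
  proof -
    have cr: "cross3 (r s 0) (tau s) = (r0 s \<bullet> nrm s) *\<^sub>R e3" "cross3 (r s 0) (nrm s) = - (r0 s \<bullet> tau s) *\<^sub>R e3"
      unfolding r0_def[symmetric]
      by (simp_all add: vec_eq_iff forall_3 r0_eq tau_eq nrm_eq cross3_def vector_def inner_vec_def sum_3)
    show ?thesis
      unfolding edge_moment_def edge_force_def stresses[OF s zero_in_J] transverse_shear[OF s zero_in_J]
        cross_add_right cross_mult_right cr vec_eq_iff forall_3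
      using nu_bounds
      by (simp add: shear_def twist_def couple_def field_simps)
  qed
  show ?thesis
    using has_integral_eq[OF eq total] by simp
qed

section \<open>The flexure problem\<close>

lemma u_hat_flexure_solution:
  assumes "B_system A B" "A_system R0 A B" "K_equation A B K"
  shows "flexure_solution R0 (u_hat A B K)"
  using assms u_hat_seam edge_force_integral edge_moment_integral u_hat_regular u_hat_equilibrium
  unfolding flexure_solution_def B_system_iff A_system_iff resultant_force_def resultant_moment_def lift_def[symmetric]
  by (simp add: has_integral_iff)

text \<open>The coefficient of \<open>K\<close> is the torsional rigidity, which is positive.\<close>

lemma K_equation_unique_solution: "\<exists>!K. K_equation A B K"
proof -
  have ex1: "c \<noteq> 0 \<Longrightarrow> \<exists>!k. k * c = d" for c d :: real
    by (rule ex1I[of _ "d / c"]) (auto simp: field_simps)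
  have "0 < 2 * (1 - nu) * (C * area\<^sup>2 / sbar + D * sbar)"
    using nu_bounds C_pos D_pos sbar_pos by (intro mult_pos_pos add_nonneg_pos) auto
  then show ?thesis
    unfolding K_equation_def by (intro ex1 less_imp_neq[THEN not_sym])
qed

end

theorem theorem3:
  fixes x :: "real \<Rightarrow> real ^ 2" and sbar ell E h nu :: real and R0 :: "real ^ 2"
  assumes "koiter_tube x sbar ell E h nu"
  shows
    "(\<forall>A. \<exists>!B. koiter_tube.B_system x sbar E h nu A B) \<and>
     (\<exists>!A. \<exists>B. koiter_tube.B_system x sbar E h nu A B \<and>
               koiter_tube.A_system x sbar E h nu R0 A B) \<and>
     (\<forall>A B. koiter_tube.B_system x sbar E h nu A B \<and>
            koiter_tube.A_system x sbar E h nu R0 A B \<longrightarrow>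
        (\<exists>!K. koiter_tube.K_equation x sbar E h nu A B K) \<and>
        (\<forall>K. koiter_tube.K_equation x sbar E h nu A B K \<longrightarrow>
           koiter_tube.flexure_solution x sbar ell E h nu R0
             (koiter_tube.u_hat x sbar E h nu A B K) \<and>
           (third_derivative_closed x sbar \<longrightarrow>
              koiter_tube.seam_continuity_ss sbar ell
                (koiter_tube.u_hat x sbar E h nu A B K))))"
proof -
  interpret koiter_tube x sbar ell E h nu by fact
  have "seam_continuity_ss (u_hat A B K)"
    if "B_system A B" "A_system R0 A B" "third_derivative_closed x sbar" for A B K
    using u_hat_seam_ss that unfolding B_system_iff A_system_iff by blast
  then show ?thesis
    using B_system_unique_solution A_system_unique_solution K_equation_unique_solution
      u_hat_flexure_solution by simp
qed

end
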